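(* Suppose that $d$ is a positive rational number and $t\ge -1$ is an integer. There exists a point in $E_3(K_t)$ with abscissa ($x$-coordinate) $(\theta_t-1)/d^2$ if and only if $$(d,t)\in\{(1,3),(1,39),(13,44103),(13,1498179)\}.$$
   Context: For an integer $t\ge -1$, let $g_t(X)=X^3-tX^2-(t+3)X-1$ (irreducible over $\mathbb{Q}$ with three real roots), let $\theta_t$ be the largest real root of $g_t$, and let $K_t=\mathbb{Q}(\theta_t)$. $E_3$ is the elliptic curve $y^2=x^3-9x$ over $\mathbb{Q}$. *)

theory Defs
  imports
    Complex_Main
    "HOL-Computational_Algebra.Polynomial"
    "HOL-Algebra.Algebraic_Closure_Type"
    "HOL-Algebra.Generated_Fields"
begin

text \<open>For \<open>t \<ge> -1\<close> the polynomial \<open>g t\<close> has three real roots, so the maximum defining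
  \<open>theta t\<close> ranges over a finite nonempty set.\<close>

definition g :: "int \<Rightarrow> real poly" where
  "g t = [: -1, - (of_int t + 3), - of_int t, 1 :]"

definition theta :: "int \<Rightarrow> real" where
  "theta t = Max {x. poly (g t) x = 0}"

definition K :: "int \<Rightarrow> real set" where
  "K t = generate_field (ring_of_type_algebra :: real ring) (insert (theta t) \<rat>)"

datatype 'a curve_point = Infinity | Affine (abscissa: 'a) (ordinate: 'a)

text \<open>The points of the curve \<open>y\<^sup>2 = x\<^sup>3 + a x + b\<close> with coordinates in the subfield \<open>F\<close>.\<close>

definition weierstrass_points :: "'a::field \<Rightarrow> 'a \<Rightarrow> 'a set \<Rightarrow> 'a curve_point set" where
  "weierstrass_points a b F =
     insert Infinity {Affine x y | x y. x \<in> F \<and> y \<in> F \<and> y ^ 2 = x ^ 3 + a * x + b}"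

definition E3 :: "real set \<Rightarrow> real curve_point set" where
  "E3 F = weierstrass_points (-9) 0 F"

end

theory Submission
  imports
    Defs
    "HOL-Computational_Algebra.Nth_Powers"
    "HOL-Analysis.Analysis"
    "HOL-Number_Theory.Cong"
begin

text \<open>A point of \<open>E3\<close> over the cubic field whose abscissa generates the field is cut out, together with its
  conjugates, by a function with a single rational residual zero. As 3 is not a congruent number, the
  residual zero is a torsion point; signs and a 3-adic argument leave only the case that the three
  conjugates lie on a line. Comparing coefficients, this case amounts to \<open>f\<^sup>2 + 1 = 2 d\<^sup>4\<close>, whose only
  positive solutions are \<open>d = 1\<close> and \<open>d = 13\<close> (Ljunggren). Ljunggren's equation becomes a quartic Thue equation for
  \<open>\<xi> = u + v \<i>\<close>. It is bounded by the Thue--Siegel method: the known solution \<open>3 + 2 \<i>\<close> generates Pade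
  approximants of a fourth root, and pairing them with \<open>\<xi>\<close> gives odd integers that are
  too small unless \<open>\<xi>\<close> is small. The remaining range is a finite check along a Pell sequence.\<close>

section \<open>3 is not a congruent number\<close>

text \<open>Comparing coefficients brings in the norm \<open>2 t + 3 > 0\<close> of
  \<open>theta t - 1\<close>. Its sign makes the residual abscissa nonnegative, and abscissa 0 would
  equate a positive and a negative number. At the positive torsion point no sign decides, hence the
  3-adic argument. The Thue equation needs an explicit and small bound. A solution of size
  \<open>x\<close> points towards a fourth root with an error of order \<open>x^-3\<close>, while
  the approximants grow like \<open>3848^n\<close> and their errors decay like
  \<open>(4/239)^n\<close>. The contradiction for large \<open>x\<close> rests on 3848 being smaller
  than the cube of 239/4; it is in fact close to the square. Such arguments usually require that one
  of two consecutive approximants gives a nonzero number. Here parity does this: clearing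
  denominators by the exact power of 2 in \<open>fact n\<close> makes the last term of each
  denominator odd and leaves the other terms even. Over the Gaussian integers the two conjugate
  forms combine into a single imaginary part, and that is the integer to be bounded.\<close>

lemma coprime_mult_eq_square_natE:
  fixes a b c :: nat
  assumes "coprime a b" "a * b = c ^ 2"
  obtains x y where "a = x ^ 2" "b = y ^ 2"
proof -
  have "is_nth_power 2 (a * b)" using assms by auto
  then have "is_nth_power 2 a" "is_nth_power 2 b"
    using is_nth_power_mult_coprime_nat_iff[OF assms(1)] by auto
  then show thesis using that by (auto simp: is_nth_power_def)
qed

lemma coprime_mult_eq_three_square_natE:
  fixes a b c :: nat
  assumes "coprime a b" "a * b = 3 * c ^ 2"
  obtains x y where "a = 3 * x ^ 2" "b = y ^ 2" | x y where "a = x ^ 2" "b = 3 * y ^ 2"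
proof -
  have p3: "prime (3::nat)" by (simp add: prime_nat_iff' atLeastLessThan_nat_numeral)
  have "3 dvd a * b" using assms by simp
  then consider "3 dvd a" | "3 dvd b" using p3 prime_dvd_mult_iff by blast
  then show thesis
  proof cases
    case 1
    then obtain a' where a': "a = 3 * a'" by auto
    then have "coprime a' b" "a' * b = c ^ 2" using assms by auto
    then obtain x y where "a' = x ^ 2" "b = y ^ 2" by (rule coprime_mult_eq_square_natE)
    then show thesis using that(1) a' by blast
  next
    case 2
    then obtain b' where b': "b = 3 * b'" by auto
    then have "coprime a b'" "a * b' = c ^ 2" using assms by auto
    then obtain x y where "a = x ^ 2" "b' = y ^ 2" by (rule coprime_mult_eq_square_natE)
    then show thesis using that(2) b' by blast
  qed
qed

lemma pythagorean_tripleE: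
  fixes u v p :: nat
  assumes "u ^ 2 + v ^ 2 = p ^ 2" "coprime u v" "even u"
  obtains a b where "u = 2 * a * b" "v + b ^ 2 = a ^ 2" "p = a ^ 2 + b ^ 2" "coprime a b"
proof -
  have "odd v" using assms(2,3) by auto
  moreover have "odd (p ^ 2)" using assms(1,3) \<open>odd v\<close> by (metis even_add even_power)
  ultimately have "even (p + v)" by simp
  have "v ^ 2 \<le> p ^ 2" using assms(1) by linarith
  then have "v \<le> p" by simp
  \<comment> \<open>Here \<open>k\<close> and \<open>k + v\<close> are half of \<open>p - v\<close>
    and half of \<open>p + v\<close>; their product is the square of half the even leg.\<close>
  then obtain k where k: "p = v + 2 * k"
    using \<open>even (p + v)\<close> by (metis dvdE even_add even_diff_nat le_add_diff_inverse)
  obtain w where w: "u = 2 * w" using assms(3) by auto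
  have kw: "k * (k + v) = w ^ 2"
    using assms(1) unfolding k w by (simp add: power2_eq_square algebra_simps)
  have "coprime k v"
  proof (rule ccontr)
    assume "\<not> coprime k v"
    then obtain q where q: "prime q" "q dvd k" "q dvd v"
      by (metis coprime_iff_gcd_eq_1 gcd_nat.boundedE prime_factor_nat)
    then have "q dvd w ^ 2" using kw by (metis dvd_mult2)
    then have "q dvd w" using q(1) prime_dvd_power by blast
    then have "q dvd u" using w by simp
    then show False using q assms(2) by (metis coprime_common_divisor_nat not_prime_1)
  qed
  then have "coprime k (k + v)" by (simp add: coprime_iff_gcd_eq_1)
  then obtain b a where ab: "k = b ^ 2" "k + v = a ^ 2"
    using kw by (rule coprime_mult_eq_square_natE)
  show thesis
  proof (rule that[of a b])
    have "w ^ 2 = (a * b) ^ 2" using kw ab by (simp add: power_mult_distrib mult.commute)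
    then have "w = a * b" by simp
    then show "u = 2 * a * b" using w by simp
    show "v + b ^ 2 = a ^ 2" "p = a ^ 2 + b ^ 2" using ab k by auto
    show "coprime a b" using \<open>coprime k (k + v)\<close> ab by (simp add: coprime_commute)
  qed
qed

lemma three_dvd_sum_squares:
  fixes x y :: nat
  assumes "3 dvd x ^ 2 + y ^ 2"
  shows "3 dvd x \<and> 3 dvd y"
proof -
  have "x mod 3 \<in> {0,1,2}" "y mod 3 \<in> {0,1,2}" by auto
  moreover have "((x mod 3) ^ 2 + (y mod 3) ^ 2) mod 3 = 0"
  proof -
    have "((x mod 3) ^ 2 + (y mod 3) ^ 2) mod 3 = (x ^ 2 + y ^ 2) mod 3" 
      using mod_add_eq[of "(x mod 3) ^ 2" 3 "(y mod 3) ^ 2"] mod_add_eq[of "x ^ 2" 3 "y ^ 2"]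
        power_mod[of x 3 2] power_mod[of y 3 2] by simp
    then show ?thesis using assms by simp
  qed
  ultimately show ?thesis by (auto simp: power2_eq_square numeral_2_eq_2[symmetric])
qed

text \<open>Fermat descent on \<open>e\<close>. Half the difference and half the sum of
  \<open>r\<close> and \<open>q\<close> are the legs of a right triangle with hypotenuse
  \<open>p\<close> and area \<open>3 f^2\<close>, where \<open>e = 2 f\<close>. In the
  parametrization by \<open>a\<close>, \<open>b\<close> this area is
  \<open>a b (a - b) (a + b)\<close>; the factors are coprime, so they are squares apart from one
  factor 3. Modulo 3 this factor can only sit in \<open>b\<close>, and then \<open>a - b\<close>,
  \<open>a\<close>, \<open>a + b\<close> are squares in progression with difference
  \<open>3 B^2\<close> and \<open>B < e\<close>.\<close>

lemma no_square_progression_coprime: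
  fixes p q r e :: nat
  assumes "coprime p e" "q ^ 2 + 3 * e ^ 2 = p ^ 2" "p ^ 2 + 3 * e ^ 2 = r ^ 2"
  shows "e = 0"
  using assms
proof (induction e arbitrary: p q r rule: less_induct)
  case (less e)
  show ?case
  proof (rule ccontr)
    assume e0: "e \<noteq> 0"
    have rq: "r ^ 2 = q ^ 2 + 6 * e ^ 2" using less.prems by linarith
    have "even (r + q)" using rq by (metis even_add even_mult_iff even_numeral even_power pos2)
    have "q ^ 2 \<le> r ^ 2" using rq by linarith
    then have "q \<le> r" by simp
    then obtain s where s: "r = q + 2 * s"
      using \<open>even (r + q)\<close> by (metis dvdE even_add even_diff_nat le_add_diff_inverse)
    have se: "2 * (s * (q + s)) = 3 * e ^ 2"
      using rq unfolding s by (simp add: power2_eq_square algebra_simps)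
    then have "even e" by (metis dvd_triv_left even_mult_iff even_power odd_numeral)
    then obtain f where f: "e = 2 * f" by auto
    have sf: "s * (q + s) = 6 * f ^ 2" using se f by (simp add: power_mult_distrib)
    have f0: "f > 0" using e0 f by auto
    have sp: "s ^ 2 + (q + s) ^ 2 = p ^ 2"
    proof -
      have "s ^ 2 + (q + s) ^ 2 = q ^ 2 + 2 * (s * (q + s))"
        by (simp add: power2_eq_square algebra_simps)
      then show ?thesis using less.prems(2) se by simp
    qed
    \<comment> \<open>A common prime of the legs divides the hypotenuse, hence not \<open>f\<close>;
      its square would then divide the squarefree number 6.\<close>
    have cop: "coprime s (q + s)"
    proof (rule ccontr)
      assume "\<not> coprime s (q + s)"
      then obtain l where l: "prime l" "l dvd s" "l dvd q + s"
        by (metis coprime_iff_gcd_eq_1 gcd_nat.boundedE prime_factor_nat)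
      have "l dvd s ^ 2" "l dvd (q + s) ^ 2" using l by (simp_all add: power2_eq_square)
      then have "l dvd p ^ 2" by (metis sp dvd_add)
      then have "l dvd p" using l(1) prime_dvd_power by blast
      then have "\<not> l dvd f"
        using less.prems(1) l(1) f by (metis coprime_common_divisor_nat dvd_mult not_prime_1)
      then have "coprime (l ^ 2) (f ^ 2)" using l(1) by (simp add: prime_imp_coprime_nat)
      moreover have "l ^ 2 dvd 6 * f ^ 2"
        using l sf by (metis mult_dvd_mono power2_eq_square)
      ultimately have l6: "l ^ 2 dvd 6" by (simp add: coprime_dvd_mult_left_iff)
      then have "l ^ 2 \<le> 6" by (simp add: dvd_imp_le)
      have "l < 3"
      proof (rule ccontr)
        assume "\<not> l < 3"
        then have "3 ^ 2 \<le> l ^ 2" using power_mono[of 3 l 2] by simp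
        then show False using \<open>l ^ 2 \<le> 6\<close> by simp
      qed
      moreover have "l \<ge> 2" using l(1) prime_ge_2_nat by blast
      ultimately have "l = 2" by simp
      then show False using l6 by simp
    qed
    obtain u v where uv: "u ^ 2 + v ^ 2 = p ^ 2" "coprime u v" "even u" "u * v = 6 * f ^ 2"
    proof (cases "even s")
      case True
      then show thesis using that[of s "q + s"] sp cop sf by auto
    next
      case False
      then have "even (q + s)" using sf by (metis dvd_mult2 even_mult_iff even_numeral)
      then show thesis using that[of "q + s" s] sp cop sf
        by (simp add: add.commute coprime_commute mult.commute)
    qed
    then obtain a b where ab: "u = 2 * a * b" "v + b ^ 2 = a ^ 2" "coprime a b"
      by (metis pythagorean_tripleE)
    have abv: "(a * b) * v = 3 * f ^ 2" using uv(4) ab(1) by simp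
    have "v > 0" using abv f0 by (intro Nat.gr0I) auto
    then have "b ^ 2 < a ^ 2" using ab(2) by linarith
    then have "b < a" by (simp add: power_less_imp_less_base)
    then obtain x where x: "a = b + x" "x > 0" using less_imp_add_positive by blast
    have v: "v = x * (a + b)" using ab(2) x by (simp add: power2_eq_square algebra_simps)
    have c1: "coprime (a * b) v" using uv(2) ab(1) by auto
    have c2: "coprime x (a + b)"
    proof (rule ccontr)
      assume "\<not> coprime x (a + b)"
      then obtain l where l: "prime l" "l dvd x" "l dvd a + b"
        by (metis coprime_iff_gcd_eq_1 gcd_nat.boundedE prime_factor_nat)
      have "l dvd (a + b) + x" using l by simp
      moreover have "(a + b) + x = 2 * a" using x by simp
      ultimately have "l dvd 2 * a" by simp
      have "l dvd v" using l v by simp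
      moreover have "l dvd u" using \<open>l dvd 2 * a\<close> ab(1) by simp
      ultimately show False using uv(2) l(1) by (metis coprime_common_divisor_nat not_prime_1)
    qed
    have no3: "\<not> (3 dvd a \<and> 3 dvd b)" using ab(3)
      by (metis coprime_common_divisor_nat numeral_eq_one_iff semiring_norm(86))
    from c1 abv show False
    proof (rule coprime_mult_eq_three_square_natE)
      fix m n assume mn: "a * b = 3 * m ^ 2" "v = n ^ 2"
      from c2 mn(2) v obtain D C where DC: "x = D ^ 2" "a + b = C ^ 2"
        by (metis coprime_mult_eq_square_natE)
      from ab(3) mn(1) show False
      proof (rule coprime_mult_eq_three_square_natE)
        fix A B assume AB: "a = 3 * A ^ 2" "b = B ^ 2"
        have "D ^ 2 + C ^ 2 = 3 * (2 * A ^ 2)" using DC x AB by linarith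
        then have "3 dvd D \<and> 3 dvd C" using three_dvd_sum_squares by (metis dvd_triv_left)
        then have "3 dvd x" "3 dvd a + b" using DC by auto
        then show False using c2
          by (metis coprime_common_divisor_nat numeral_eq_one_iff semiring_norm(86))
      next
        fix A B assume AB: "a = A ^ 2" "b = 3 * B ^ 2"
        have B: "B < e"
        proof -
          have "B ^ 2 * 1 \<le> a * b * v" using AB \<open>v > 0\<close> \<open>b < a\<close>
            by (intro mult_mono) (auto simp: Suc_leI)
          then have "B ^ 2 \<le> 3 * f ^ 2" using abv by simp
          moreover have "0 < f ^ 2" "e ^ 2 = 4 * f ^ 2" using f f0 by (simp_all add: power_mult_distrib)
          ultimately have "B ^ 2 < e ^ 2" by linarith
          then show ?thesis by (simp add: power_less_imp_less_base)
        qed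
        have "B = 0"
          using less.IH[OF B, of A D C] AB DC ab(3) x by simp
        then have "a * b * v = 0" using AB by simp
        then show False using abv f0 by simp
      qed
    next
      fix m n assume mn: "a * b = m ^ 2" "v = 3 * n ^ 2"
      from ab(3) mn(1) obtain A B where AB: "a = A ^ 2" "b = B ^ 2"
        by (metis coprime_mult_eq_square_natE)
      have no3': False if "3 dvd A ^ 2 + B ^ 2"
        using three_dvd_sum_squares[OF that] no3 AB by auto
      have "x * (a + b) = 3 * n ^ 2" using mn(2) v by simp
      with c2 show False
      proof (rule coprime_mult_eq_three_square_natE)
        fix D C assume DC: "x = 3 * D ^ 2" "a + b = C ^ 2"
        have "C ^ 2 = 2 * b + x" using DC(2) x by simp
        then have "C ^ 2 + B ^ 2 = 3 * (D ^ 2 + B ^ 2)" using DC(1) AB(2) by simp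
        then have "3 dvd C" "3 dvd B" using three_dvd_sum_squares by (metis dvd_triv_left)+
        then have "3 dvd A ^ 2 + B ^ 2" using DC AB by auto
        then show False by (rule no3')
      next
        fix D C assume DC: "x = D ^ 2" "a + b = 3 * C ^ 2"
        then have "3 dvd A ^ 2 + B ^ 2" using AB by simp
        then show False by (rule no3')
      qed
    qed
  qed
qed

lemma no_square_progression:
  fixes p q r e :: nat
  assumes "q ^ 2 + 3 * e ^ 2 = p ^ 2" "p ^ 2 + 3 * e ^ 2 = r ^ 2"
  shows "e = 0"
proof (cases "p = 0")
  case True
  then show ?thesis using assms by simp
next
  case False
  define d where "d = gcd p e"
  have "d > 0" using False d_def by simp
  obtain p' e' where pe: "p = d * p'" "e = d * e'" "coprime p' e'"
    using gcd_coprime_exists[of p e] \<open>d > 0\<close> d_def by (metis less_numeral_extra(3) mult.commute)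
  have "d ^ 2 dvd r ^ 2" using assms(2) pe
    by (metis dvd_add dvd_mult dvd_triv_left power_mult_distrib)
  then obtain r' where r: "r = d * r'" by auto
  have "q ^ 2 = d ^ 2 * p' ^ 2 - d ^ 2 * (3 * e' ^ 2)"
    using assms(1) pe by (simp add: power_mult_distrib)
  then have "d ^ 2 dvd q ^ 2" by (metis dvd_diff_nat dvd_triv_left)
  then obtain q' where q: "q = d * q'" by auto
  have "d ^ 2 * (q' ^ 2 + 3 * e' ^ 2) = d ^ 2 * p' ^ 2"
       "d ^ 2 * (p' ^ 2 + 3 * e' ^ 2) = d ^ 2 * r' ^ 2"
    using assms pe q r by (simp_all add: power_mult_distrib algebra_simps)
  then have "q' ^ 2 + 3 * e' ^ 2 = p' ^ 2" "p' ^ 2 + 3 * e' ^ 2 = r' ^ 2"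
    using \<open>d > 0\<close> by simp_all
  then have "e' = 0" using pe(3) no_square_progression_coprime by blast
  then show ?thesis using pe by simp
qed

lemma rat_quotientE:
  fixes x :: rat
  obtains a n :: int where "n > 0" "x = of_int a / of_int n" "coprime a n"
  using that by (metis quotient_of_div quotient_of_denom_pos quotient_of_coprime surj_pair)

lemma rat_common_denominator3:
  fixes x y z :: rat
  obtains n :: nat and a b c :: int
  where "n > 0" "x * of_nat n = of_int a" "y * of_nat n = of_int b" "z * of_nat n = of_int c"
proof -
  obtain a1 n1 where 1: "n1 > 0" "x = of_int a1 / of_int n1" by (rule rat_quotientE)
  obtain a2 n2 where 2: "n2 > 0" "y = of_int a2 / of_int n2" by (rule rat_quotientE)
  obtain a3 n3 where 3: "n3 > 0" "z = of_int a3 / of_int n3" by (rule rat_quotientE)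
  have n: "of_nat (nat (n1 * n2 * n3)) = (of_int (n1 * n2 * n3) :: rat)"
    using 1(1) 2(1) 3(1) by (simp del: of_int_mult)
  show thesis
    by (rule that[of "nat (n1 * n2 * n3)" "a1 * n2 * n3" "a2 * n1 * n3" "a3 * n1 * n2"], unfold n)
       (use 1 2 3 in auto)
qed

lemma congruent_three_rational_points:
  fixes x y :: rat
  assumes "y ^ 2 = x ^ 3 - 9 * x"
  shows "y = 0"
proof (rule ccontr)
  assume y: "y \<noteq> 0"
  \<comment> \<open>the abscissa of the double of a point and its translates by 3 and -3 are squares\<close>
  define p where "p = (x ^ 2 + 9) / (2 * y)"
  define q where "q = (x ^ 2 - 6 * x - 9) / (2 * y)"
  define r where "r = (x ^ 2 + 6 * x - 9) / (2 * y)"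
  have pq: "q ^ 2 + 3 = p ^ 2"
  proof -
    have "(x ^ 2 - 6 * x - 9) ^ 2 + 3 * (2 * y) ^ 2 = (x ^ 2 + 9) ^ 2"
      using assms by (simp add: power_mult_distrib power2_eq_square power3_eq_cube algebra_simps)
    then show ?thesis unfolding p_def q_def using y by (simp add: power_divide divide_simps)
  qed
  have pr: "p ^ 2 + 3 = r ^ 2"
  proof -
    have "(x ^ 2 + 9) ^ 2 + 3 * (2 * y) ^ 2 = (x ^ 2 + 6 * x - 9) ^ 2"
      using assms by (simp add: power_mult_distrib power2_eq_square power3_eq_cube algebra_simps)
    then show ?thesis unfolding p_def r_def using y by (simp add: power_divide divide_simps)
  qed
  obtain n a b c where n: "n > 0" "p * of_nat n = of_int a" "q * of_nat n = of_int b" "r * of_nat n = of_int c"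
    by (rule rat_common_denominator3)
  have "(of_int (b ^ 2 + 3 * int n ^ 2) :: rat) = (q * of_nat n) ^ 2 + 3 * of_nat n ^ 2"
    using n by simp
  also have "\<dots> = (q ^ 2 + 3) * of_nat n ^ 2" by (simp add: algebra_simps)
  also have "\<dots> = of_int (a ^ 2)" using n by (simp add: pq power_mult_distrib[symmetric])
  finally have 1: "b ^ 2 + 3 * int n ^ 2 = a ^ 2" by (metis of_int_eq_iff)
  have "(of_int (a ^ 2 + 3 * int n ^ 2) :: rat) = (p * of_nat n) ^ 2 + 3 * of_nat n ^ 2"
    using n by simp
  also have "\<dots> = (p ^ 2 + 3) * of_nat n ^ 2" by (simp add: algebra_simps)
  also have "\<dots> = of_int (c ^ 2)" using n by (simp add: pr power_mult_distrib[symmetric])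
  finally have 2: "a ^ 2 + 3 * int n ^ 2 = c ^ 2" by (metis of_int_eq_iff)
  have "int (nat \<bar>b\<bar> ^ 2 + 3 * n ^ 2) = int (nat \<bar>a\<bar> ^ 2)"
       "int (nat \<bar>a\<bar> ^ 2 + 3 * n ^ 2) = int (nat \<bar>c\<bar> ^ 2)" using 1 2 by simp_all
  then have "n = 0" using no_square_progression by (metis of_nat_eq_iff)
  then show False using n by simp
qed

section \<open>The cubic field\<close>

text \<open>For a cubic, having no rational root amounts to irreducibility. In this elementary form
  it can be checked directly, and it makes rational coordinates with respect to 1,
  \<open>\<phi>\<close>, \<open>\<phi> ^ 2\<close> unique.\<close>

locale irreducible_cubic =
  fixes \<phi> p q r :: real
  assumes coeff_Rats: "p \<in> \<rat>" "q \<in> \<rat>" "r \<in> \<rat>"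
    and root: "\<phi> ^ 3 + p * \<phi> ^ 2 + q * \<phi> + r = 0"
    and no_rational_root: "x \<in> \<rat> \<Longrightarrow> x ^ 3 + p * x ^ 2 + q * x + r \<noteq> 0"
begin

definition span3 :: "real set" where
  "span3 = {a + b * \<phi> + c * \<phi> ^ 2 | a b c. a \<in> \<rat> \<and> b \<in> \<rat> \<and> c \<in> \<rat>}"

lemma span3I: "a \<in> \<rat> \<Longrightarrow> b \<in> \<rat> \<Longrightarrow> c \<in> \<rat> \<Longrightarrow> a + b * \<phi> + c * \<phi> ^ 2 \<in> span3"
  by (auto simp: span3_def)

lemma span3E:
  assumes "x \<in> span3"
  obtains a b c where "a \<in> \<rat>" "b \<in> \<rat>" "c \<in> \<rat>" "x = a + b * \<phi> + c * \<phi> ^ 2"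
  using assms by (auto simp: span3_def)

lemma Rats_subset_span3: "\<rat> \<subseteq> span3"
  using span3I[where b = 0 and c = 0] by auto

lemma irrational: "\<phi> \<notin> \<rat>"
  using no_rational_root root by blast

lemma linear_independent2:
  assumes "a \<in> \<rat>" "b \<in> \<rat>" "a + b * \<phi> = 0"
  shows "a = 0" "b = 0"
proof -
  have "b = 0"
  proof (rule ccontr)
    assume "b \<noteq> 0"
    then have "\<phi> = - a / b" using assms(3) by (simp add: field_simps)
    then show False using irrational assms by auto
  qed
  then show "a = 0" "b = 0" using assms(3) by auto
qed

lemma quadratic_times_linear:
  "(\<phi> ^ 2 + u * \<phi> + v) * (\<phi> + (p - u)) = (v * (p - u) - r) + (v + u * (p - u) - q) * \<phi>"
proof -
  have "(\<phi> ^ 2 + u * \<phi> + v) * (\<phi> + (p - u)) =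
      (v * (p - u) - r) + (v + u * (p - u) - q) * \<phi> + (\<phi> ^ 3 + p * \<phi> ^ 2 + q * \<phi> + r)"
    by (simp add: algebra_simps power2_eq_square power3_eq_cube)
  then show ?thesis using root by simp
qed

text \<open>A monic quadratic in the root becomes linear after multiplication by a suitable linear
  factor, and this linear expression is nonzero because the cubic has no rational root.\<close>

lemma quadratic_times_linear_neq_0:
  assumes "u \<in> \<rat>" "v \<in> \<rat>"
  shows "(v * (p - u) - r) + (v + u * (p - u) - q) * \<phi> \<noteq> 0"
proof
  assume *: "(v * (p - u) - r) + (v + u * (p - u) - q) * \<phi> = 0"
  have "v * (p - u) - r \<in> \<rat>" "v + u * (p - u) - q \<in> \<rat>" using assms coeff_Rats by auto
  then have "v * (p - u) - r = 0" "v + u * (p - u) - q = 0"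
    using linear_independent2[OF _ _ *] by blast+
  moreover have "(u - p) ^ 3 + p * (u - p) ^ 2 + q * (u - p) + r =
      (p - u) * (v + u * (p - u) - q) - (v * (p - u) - r)"
    by (simp add: algebra_simps power2_eq_square power3_eq_cube)
  ultimately have "(u - p) ^ 3 + p * (u - p) ^ 2 + q * (u - p) + r = 0" by simp
  then show False using no_rational_root[of "u - p"] assms coeff_Rats by auto
qed

lemma linear_independent3:
  assumes "a \<in> \<rat>" "b \<in> \<rat>" "c \<in> \<rat>" "a + b * \<phi> + c * \<phi> ^ 2 = 0"
  shows "a = 0" "b = 0" "c = 0"
proof -
  show c: "c = 0"
  proof (rule ccontr)
    assume "c \<noteq> 0"
    have "c * (\<phi> ^ 2 + (b / c) * \<phi> + a / c) = a + b * \<phi> + c * \<phi> ^ 2"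
      using \<open>c \<noteq> 0\<close> by (simp add: ring_distribs)
    then have "\<phi> ^ 2 + (b / c) * \<phi> + a / c = 0" using assms(4) \<open>c \<noteq> 0\<close> by (metis mult_eq_0_iff)
    then have "(\<phi> ^ 2 + (b / c) * \<phi> + a / c) * (\<phi> + (p - b / c)) = 0" by (simp only: mult_zero_left)
    then show False
      using quadratic_times_linear_neq_0[of "b / c" "a / c"] assms
      unfolding quadratic_times_linear by (metis Rats_divide)
  qed
  then show "a = 0" "b = 0" using linear_independent2[of a b] assms by auto
qed

lemma span3_add: "x \<in> span3 \<Longrightarrow> y \<in> span3 \<Longrightarrow> x + y \<in> span3"
proof -
  assume xy: "x \<in> span3" "y \<in> span3"
  obtain a b c where "a \<in> \<rat>" "b \<in> \<rat>" "c \<in> \<rat>" "x = a + b * \<phi> + c * \<phi> ^ 2"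
    using xy(1) by (rule span3E)
  moreover obtain a' b' c' where "a' \<in> \<rat>" "b' \<in> \<rat>" "c' \<in> \<rat>" "y = a' + b' * \<phi> + c' * \<phi> ^ 2"
    using xy(2) by (rule span3E)
  ultimately show ?thesis using span3I[of "a + a'" "b + b'" "c + c'"] by (simp add: algebra_simps)
qed

lemma span3_mult: "x \<in> span3 \<Longrightarrow> y \<in> span3 \<Longrightarrow> x * y \<in> span3"
proof -
  assume xy: "x \<in> span3" "y \<in> span3"
  obtain a b c where x: "a \<in> \<rat>" "b \<in> \<rat>" "c \<in> \<rat>" "x = a + b * \<phi> + c * \<phi> ^ 2"
    using xy(1) by (rule span3E)
  obtain a' b' c' where y: "a' \<in> \<rat>" "b' \<in> \<rat>" "c' \<in> \<rat>" "y = a' + b' * \<phi> + c' * \<phi> ^ 2"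
    using xy(2) by (rule span3E)
  \<comment> \<open>The product has degree 4 in \<open>\<phi>\<close>; its quotient by the cubic is
    \<open>c * c' * X + m\<close>.\<close>
  define m where "m = b * c' + c * b' - p * (c * c')"
  have "x * y = (a * a' - r * m) + (a * b' + b * a' - r * (c * c') - q * m) * \<phi>
      + (a * c' + b * b' + c * a' - q * (c * c') - p * m) * \<phi> ^ 2
      + (\<phi> ^ 3 + p * \<phi> ^ 2 + q * \<phi> + r) * (c * c' * \<phi> + m)"
    unfolding x(4) y(4) m_def by (simp add: algebra_simps power2_eq_square power3_eq_cube)
  then have e: "x * y = (a * a' - r * m) + (a * b' + b * a' - r * (c * c') - q * m) * \<phi>
      + (a * c' + b * b' + c * a' - q * (c * c') - p * m) * \<phi> ^ 2"
    using root by simp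
  have "m \<in> \<rat>" using x y coeff_Rats by (auto simp: m_def)
  then show ?thesis unfolding e using x(1-3) y(1-3) coeff_Rats by (intro span3I) auto
qed

lemma inverse_linear_in_span3:
  assumes "a \<in> \<rat>" "b \<in> \<rat>"
  shows "inverse (a + b * \<phi>) \<in> span3"
proof (cases "b = 0")
  case True
  then show ?thesis using assms Rats_subset_span3 by auto
next
  case False
  define s where "s = - (a / b)"
  have s: "s \<in> \<rat>" using assms s_def by auto
  define n where "n = s ^ 3 + p * s ^ 2 + q * s + r"
  have n: "n \<in> \<rat>" "n \<noteq> 0" using s coeff_Rats no_rational_root[OF s] by (auto simp: n_def)
  \<comment> \<open>Horner division of the cubic by \<open>X - s\<close>, with the nonzero value
    \<open>n\<close> at \<open>s\<close> as remainder.\<close>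
  have "(\<phi> - s) * ((s ^ 2 + p * s + q) + (s + p) * \<phi> + 1 * \<phi> ^ 2)
      = (\<phi> ^ 3 + p * \<phi> ^ 2 + q * \<phi> + r) - n"
    unfolding n_def by (simp add: algebra_simps power2_eq_square power3_eq_cube)
  then have "(\<phi> - s) * ((s ^ 2 + p * s + q) + (s + p) * \<phi> + 1 * \<phi> ^ 2) = - n" (is "_ * ?w = _")
    using root by simp
  then have "(b * (\<phi> - s)) * (?w * (- 1 / (b * n))) = (b * (- n)) * (- 1 / (b * n))"
    by (metis mult.assoc)
  then have "(b * (\<phi> - s)) * (?w * (- 1 / (b * n))) = 1" using n False by simp
  moreover have "b * (\<phi> - s) = a + b * \<phi>" using False by (simp add: s_def algebra_simps)
  ultimately have "inverse (a + b * \<phi>) =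
      ((s ^ 2 + p * s + q) + (s + p) * \<phi> + 1 * \<phi> ^ 2) * (- 1 / (b * n))"
    by (metis inverse_unique)
  also have "\<dots> \<in> span3"
  proof (rule span3_mult)
    show "?w \<in> span3" by (rule span3I) (use s coeff_Rats in auto)
    have "- 1 / (b * n) \<in> \<rat>" using n assms by simp
    then show "- 1 / (b * n) \<in> span3" using Rats_subset_span3 by blast
  qed
  finally show ?thesis .
qed

lemma span3_inverse:
  assumes "x \<in> span3"
  shows "inverse x \<in> span3"
proof -
  obtain a b c where abc: "a \<in> \<rat>" "b \<in> \<rat>" "c \<in> \<rat>" "x = a + b * \<phi> + c * \<phi> ^ 2"
    using assms by (rule span3E)
  show ?thesis
  proof (cases "c = 0")
    case True
    then have "x = a + b * \<phi>" using abc(4) by simp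
    then show ?thesis using inverse_linear_in_span3 abc(1,2) by blast
  next
    case False
    define u v where uv: "u = b / c" "v = a / c"
    have R: "u \<in> \<rat>" "v \<in> \<rat>" using abc(1-3) by (simp_all add: uv)
    have x: "x = c * (\<phi> ^ 2 + u * \<phi> + v)" using False unfolding abc(4) uv by (simp add: ring_distribs)
    define l where "l = (v * (p - u) - r) + (v + u * (p - u) - q) * \<phi>"
    have l: "l \<noteq> 0" unfolding l_def by (rule quadratic_times_linear_neq_0[OF R])
    have "x * ((1 / c) * (\<phi> + (p - u)) * inverse l) =
        (c * (1 / c)) * ((\<phi> ^ 2 + u * \<phi> + v) * (\<phi> + (p - u))) * inverse l"
      unfolding x by (simp only: mult_ac)
    then have "x * ((1 / c) * (\<phi> + (p - u)) * inverse l) = 1"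
      using l False unfolding quadratic_times_linear l_def[symmetric] by simp
    then have "inverse x = (1 / c) * (\<phi> + (p - u)) * inverse l" by (rule inverse_unique)
    also have "\<dots> \<in> span3"
    proof (intro span3_mult[of _ "inverse l"] span3_mult[of "1 / c"])
      have "1 / c \<in> \<rat>" using abc(3) by simp
      then show "1 / c \<in> span3" using Rats_subset_span3 by blast
      show "\<phi> + (p - u) \<in> span3"
        using span3I[of "p - u" 1 0] R coeff_Rats by (simp add: add.commute)
      show "inverse l \<in> span3"
        unfolding l_def using R coeff_Rats by (intro inverse_linear_in_span3) auto
    qed
    finally show ?thesis .
  qed
qed

end

lemma ring_of_type_algebra_ops:
  fixes x y :: real
  defines "F \<equiv> (ring_of_type_algebra :: real ring)"
  shows "\<one>\<^bsub>F\<^esub> = 1" "\<zero>\<^bsub>F\<^esub> = 0" "x \<oplus>\<^bsub>F\<^esub> y = x + y" "x \<otimes>\<^bsub>F\<^esub> y = x * y"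
    "\<ominus>\<^bsub>F\<^esub> x = - x" "x \<noteq> 0 \<Longrightarrow> inv\<^bsub>F\<^esub> x = inverse x"
proof -
  interpret F: field F unfolding F_def by (rule field_from_type_algebra)
  show *: "\<one>\<^bsub>F\<^esub> = 1" "\<zero>\<^bsub>F\<^esub> = 0" "x \<oplus>\<^bsub>F\<^esub> y = x + y" "x \<otimes>\<^bsub>F\<^esub> y = x * y" for x y
    by (simp_all add: F_def ring_of_type_algebra_def)
  have c: "carrier F = UNIV" by (simp add: F_def ring_of_type_algebra_def)
  show "\<ominus>\<^bsub>F\<^esub> x = - x" by (rule F.minus_equality) (auto simp: * c)
  show "inv\<^bsub>F\<^esub> x = inverse x" if "x \<noteq> 0"
    by (rule F.comm_inv_char) (use that in \<open>auto simp: * c\<close>)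
qed

lemma generate_field_subset_span3:
  assumes "irreducible_cubic \<phi> p q r" "H \<subseteq> irreducible_cubic.span3 \<phi>"
  shows "generate_field (ring_of_type_algebra :: real ring) H \<subseteq> irreducible_cubic.span3 \<phi>"
proof
  interpret irreducible_cubic \<phi> p q r by fact
  fix x assume "x \<in> generate_field (ring_of_type_algebra :: real ring) H"
  then show "x \<in> span3"
  proof (induction rule: generate_field.induct)
    case (a_inv h)
    have "-1 * h \<in> span3" using a_inv Rats_subset_span3 by (intro span3_mult) auto
    then show ?case by (simp add: ring_of_type_algebra_ops)
  next
    case (m_inv h)
    then show ?case using span3_inverse by (simp add: ring_of_type_algebra_ops)
  next
    case one
    show ?case using Rats_subset_span3 by (simp add: ring_of_type_algebra_ops subset_iff)
  next
    case (incl h)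
    then show ?case using assms(2) by blast
  next
    case (eng_add h1 h2)
    then show ?case using span3_add by (simp add: ring_of_type_algebra_ops)
  next
    case (eng_mult h1 h2)
    then show ?case using span3_mult by (simp add: ring_of_type_algebra_ops)
  qed
qed

text \<open>The polynomial is monic with constant term -1, so a rational root would be 1 or -1; the
  values there are \<open>- 2 t - 3\<close> and 1.\<close>

lemma g_no_rational_root:
  assumes "x \<in> \<rat>" "t \<ge> -1"
  shows "poly (g t) x \<noteq> 0"
proof
  assume 0: "poly (g t) x = 0"
  obtain x' where "x = of_rat x'" using assms(1) by (auto elim: Rats_cases)
  obtain a n :: int where an: "n > 0" "x' = of_int a / of_int n" "coprime a n" by (rule rat_quotientE)
  have x: "x = of_int a / of_int n" using \<open>x = of_rat x'\<close> an(2) by (simp add: of_rat_divide)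
  have "x ^ 3 = of_int t * x ^ 2 + (of_int t + 3) * x + 1"
    using 0 by (simp add: g_def algebra_simps power2_eq_square power3_eq_cube)
  then have "of_int a ^ 3 = (of_int n :: real) * (of_int t * of_int a ^ 2 + (of_int t + 3) * of_int a * of_int n + of_int n ^ 2)"
    using an(1) unfolding x by (simp add: field_simps power2_eq_square power3_eq_cube)
  then have e: "a ^ 3 = n * (t * a ^ 2 + (t + 3) * a * n + n ^ 2)"
    by (metis (mono_tags, lifting) of_int_add of_int_eq_iff of_int_mult of_int_numeral of_int_power)
  then have "n dvd a ^ 3" by simp
  moreover have "coprime (a ^ 3) n" using an(3) by simp
  ultimately have "is_unit n" by (metis coprime_absorb_right)
  then have n: "n = 1" using an(1) by simp
  then have "a * (a ^ 2 - t * a - (t + 3)) = 1"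
    using e by (simp add: algebra_simps power2_eq_square power3_eq_cube)
  then have "a = 1 \<or> a = -1" by (metis dvd_triv_left zdvd1_eq abs_eq_iff' abs_1)
  then show False using e n assms(2) by auto
qed

text \<open>The sign change between 1 and \<open>t + 3\<close> makes the root set nonempty, which
  \<open>Max\<close> requires besides finiteness.\<close>

lemma theta_root:
  assumes "t \<ge> -1"
  shows "poly (g t) (theta t) = 0"
proof -
  have "poly (g t) 1 < 0" using assms by (simp add: g_def)
  moreover have "poly (g t) (of_int t + 3) > 0"
  proof -
    have "(of_int t + 3 :: real) \<ge> 2" using assms by simp
    then have "(of_int t + 3 :: real) * (of_int t + 3) \<ge> 2 * 2" by (intro mult_mono) auto
    moreover have "poly (g t) (of_int t + 3) = 2 * ((of_int t + 3) * (of_int t + 3)) - 1"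
      by (simp add: g_def algebra_simps)
    ultimately show ?thesis by linarith
  qed
  moreover have "(1::real) < of_int t + 3" using assms by simp
  ultimately obtain x where "poly (g t) x = 0" by (metis poly_IVT_pos)
  then have "{x. poly (g t) x = 0} \<noteq> {}" by auto
  moreover have "finite {x. poly (g t) x = 0}" by (rule poly_roots_finite) (simp add: g_def)
  ultimately have "theta t \<in> {x. poly (g t) x = 0}" unfolding theta_def by (rule Max_in[rotated])
  then show ?thesis by simp
qed

text \<open>The cubic is \<open>g t\<close> at \<open>X + 1\<close>. The shift moves the generator
  to the numerator \<open>theta t - 1\<close> of the prescribed abscissa, so the curve equation can
  be reduced modulo this cubic directly.\<close>

lemma irreducible_cubic_theta:
  assumes "t \<ge> -1"
  shows "irreducible_cubic (theta t - 1) (3 - of_int t) (- 3 * of_int t) (- (2 * of_int t + 3))"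
proof
  have shift: "x ^ 3 + (3 - of_int t) * x ^ 2 + (- 3 * of_int t) * x + - (2 * of_int t + 3) = poly (g t) (x + 1)"
    for x :: real by (simp add: g_def algebra_simps power2_eq_square power3_eq_cube)
  show "(theta t - 1) ^ 3 + (3 - of_int t) * (theta t - 1) ^ 2 + (- 3 * of_int t) * (theta t - 1)
      + - (2 * of_int t + 3) = 0"
    unfolding shift using theta_root[OF assms] by simp
  show "x ^ 3 + (3 - of_int t) * x ^ 2 + (- 3 * of_int t) * x + - (2 * of_int t + 3) \<noteq> 0"
    if "x \<in> \<rat>" for x :: real
    unfolding shift using g_no_rational_root[of "x + 1" t] that assms by auto
qed auto

lemma K_subset_span3:
  assumes "t \<ge> -1"
  shows "K t \<subseteq> irreducible_cubic.span3 (theta t - 1)"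
proof -
  interpret irreducible_cubic "theta t - 1" "3 - of_int t" "- 3 * of_int t" "- (2 * of_int t + 3)"
    using assms by (rule irreducible_cubic_theta)
  have "theta t \<in> span3" using span3I[of 1 1 0] by simp
  then show ?thesis unfolding K_def
    using Rats_subset_span3
    by (intro generate_field_subset_span3[OF irreducible_cubic_axioms]) auto
qed

lemma K_linear:
  assumes "a \<in> \<rat>" "b \<in> \<rat>"
  shows "a + b * theta t \<in> K t"
proof -
  have "a \<in> K t" "b \<in> K t" "theta t \<in> K t"
    using assms by (auto simp: K_def intro!: generate_field.incl)
  then show ?thesis
    using generate_field.eng_add[of a "ring_of_type_algebra :: real ring" _ "b * theta t"]
      generate_field.eng_mult[of b "ring_of_type_algebra :: real ring" _ "theta t"]
    by (simp add: K_def ring_of_type_algebra_ops)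
qed

section \<open>A 3-adic obstruction\<close>

lemma rat_square_int:
  fixes x :: real
  assumes "x \<in> \<rat>" "x ^ 2 = of_int z"
  obtains k where "x = of_int k"
proof -
  obtain x' where x': "x = of_rat x'" using assms(1) by (auto elim: Rats_cases)
  obtain a n :: int where an: "n > 0" "x' = of_int a / of_int n" "coprime a n" by (rule rat_quotientE)
  have x: "x = of_int a / of_int n" using x' an(2) by (simp add: of_rat_divide)
  have "of_int a ^ 2 = (of_int z * of_int n ^ 2 :: real)"
    using assms(2) an(1) unfolding x by (simp add: field_simps power_divide)
  then have "a ^ 2 = z * n ^ 2"
    by (simp only: of_int_mult[symmetric] of_int_power[symmetric] of_int_eq_iff)
  then have "n dvd a ^ 2" by (simp add: power2_eq_square)
  moreover have "coprime (a ^ 2) n" using an(3) by simp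
  ultimately have "is_unit n" by (metis coprime_absorb_right)
  then have "n = 1" using an(1) by simp
  then show thesis using that x by simp
qed

lemma three_dvd_of_square:
  fixes k :: int
  assumes "k ^ 2 = 3 * m"
  obtains l where "k = 3 * l" "m = 3 * l ^ 2"
proof -
  have "3 dvd k ^ 2" using assms by simp
  then have "3 dvd k" by (rule prime_dvd_power[rotated]) simp
  then obtain l where l: "k = 3 * l" by auto
  then have "m = 3 * l ^ 2" using assms by (simp add: power_mult_distrib)
  then show thesis using that l by blast
qed

text \<open>A number congruent to 1 modulo 3 is a 3-adic square and 2 is not. Concretely, for
  coprime \<open>a\<close> and \<open>b\<close> the equation modulo 3 would make both divisible by
  3.\<close>

lemma two_not_square_mod_three:
  fixes a b e :: int
  assumes "2 * a ^ 2 = b ^ 2 * e" "e mod 3 = 1"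
  shows "b = 0"
proof (rule ccontr)
  assume b: "b \<noteq> 0"
  define d where "d = gcd a b"
  have d: "d \<noteq> 0" using b d_def by simp
  obtain a' b' where ab: "a = a' * d" "b = b' * d" "coprime a' b'"
    using gcd_coprime_exists[of a b] d unfolding d_def by metis
  have "d ^ 2 * (2 * a' ^ 2) = d ^ 2 * (b' ^ 2 * e)"
    using assms(1) unfolding ab by (simp add: power_mult_distrib algebra_simps)
  then have e: "2 * a' ^ 2 = b' ^ 2 * e" using d by simp
  have "[2 * (a' mod 3) ^ 2 = 2 * a' ^ 2] (mod 3)" by (intro cong_mult cong_pow cong_refl) (simp add: cong_def)
  also have "[2 * a' ^ 2 = (b' mod 3) ^ 2 * (e mod 3)] (mod 3)"
    unfolding e by (intro cong_mult cong_pow) (simp_all add: cong_def)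
  finally have *: "(2 * (a' mod 3) ^ 2) mod 3 = (b' mod 3) ^ 2 mod 3" using assms(2) by (simp add: cong_def)
  have "a' mod 3 = 0 \<or> a' mod 3 = 1 \<or> a' mod 3 = 2" "b' mod 3 = 0 \<or> b' mod 3 = 1 \<or> b' mod 3 = 2" by presburger+
  then have "a' mod 3 = 0 \<and> b' mod 3 = 0" using * by (elim disjE) (simp_all only:, simp_all)
  then have "3 dvd a'" "3 dvd b'" by auto
  then show False using ab(3) by (auto dest: coprime_common_divisor)
qed

text \<open>Divisibility by 3 is forced step by step: \<open>n\<close> is prime to 3, then 3 divides
  \<open>k\<close>, then \<open>s = k / 3\<close>, then \<open>m\<close>. At that stage the equation
  reads as twice a square equal to a square times a number congruent to 1 modulo 3.\<close>

lemma no_integer_solution_three_adic: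
  fixes m n k :: int
  assumes "2 * (k * n ^ 3 + 3 * m ^ 3) ^ 2 + 12 * m ^ 3 * n ^ 3 * k + (9 * k ^ 2 - 9) * m ^ 2 * n ^ 4
      + 3 * m ^ 4 * n ^ 2 * (9 - 3 * k ^ 2) = 0"
    and cop: "coprime m n"
  shows "m = 0"
proof -
  have p3: "prime (3 :: int)" by simp
  have n3: "\<not> 3 dvd n"
  proof
    assume "3 dvd n"
    then obtain n' where n: "n = 3 * n'" by auto
    have "27 * (2 * k ^ 2 * 27 * n' ^ 6 + 24 * k * m ^ 3 * n' ^ 3 + 27 * k ^ 2 * m ^ 2 * n' ^ 4
        - 27 * m ^ 2 * n' ^ 4 + 9 * m ^ 4 * n' ^ 2 - 3 * k ^ 2 * m ^ 4 * n' ^ 2) + 18 * m ^ 6 =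
      2 * (k * n ^ 3 + 3 * m ^ 3) ^ 2 + 12 * m ^ 3 * n ^ 3 * k + (9 * k ^ 2 - 9) * m ^ 2 * n ^ 4
      + 3 * m ^ 4 * n ^ 2 * (9 - 3 * k ^ 2)"
      unfolding n by (simp add: algebra_simps power_numeral_reduce)
    then have "27 * (2 * k ^ 2 * 27 * n' ^ 6 + 24 * k * m ^ 3 * n' ^ 3 + 27 * k ^ 2 * m ^ 2 * n' ^ 4
        - 27 * m ^ 2 * n' ^ 4 + 9 * m ^ 4 * n' ^ 2 - 3 * k ^ 2 * m ^ 4 * n' ^ 2) + 18 * m ^ 6 = 0"
      unfolding assms(1) .
    moreover have "27 * x + 18 * y = 0 \<Longrightarrow> 3 dvd y" for x y :: int by presburger
    ultimately have "3 dvd m ^ 6" by blast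
    then have "3 dvd m" by (rule prime_dvd_power[OF p3])
    then show False using \<open>3 dvd n\<close> cop
      by (auto dest: coprime_common_divisor)
  qed
  then have n1: "n mod 3 = 1 \<or> n mod 3 = 2" by presburger
  then have "(n mod 3) ^ 2 mod 3 = 1" by auto
  then have n2: "n ^ 2 mod 3 = 1" by (simp add: power_mod)
  have "2 * (k ^ 2 * n ^ 6) - 3 * (- (8 * k * m ^ 3 * n ^ 3 + 6 * m ^ 6 + 3 * k ^ 2 * m ^ 2 * n ^ 4
      - 3 * m ^ 2 * n ^ 4 + 9 * m ^ 4 * n ^ 2 - 3 * k ^ 2 * m ^ 4 * n ^ 2)) =
      2 * (k * n ^ 3 + 3 * m ^ 3) ^ 2 + 12 * m ^ 3 * n ^ 3 * k + (9 * k ^ 2 - 9) * m ^ 2 * n ^ 4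
      + 3 * m ^ 4 * n ^ 2 * (9 - 3 * k ^ 2)"
    by (simp add: algebra_simps power_numeral_reduce)
  then have "2 * (k ^ 2 * n ^ 6) = 3 * (- (8 * k * m ^ 3 * n ^ 3 + 6 * m ^ 6 + 3 * k ^ 2 * m ^ 2 * n ^ 4
      - 3 * m ^ 2 * n ^ 4 + 9 * m ^ 4 * n ^ 2 - 3 * k ^ 2 * m ^ 4 * n ^ 2))"
    unfolding assms(1) by (simp only: right_minus_eq)
  moreover have "2 * x = 3 * y \<Longrightarrow> 3 dvd x" for x y :: int by presburger
  ultimately have "3 dvd k ^ 2 * n ^ 6" by blast
  then have "3 dvd k ^ 2 \<or> 3 dvd n ^ 6" using p3 prime_dvd_mult_iff by blast
  then have "3 dvd k ^ 2" using n3 prime_dvd_power[OF p3] by blast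
  then have "3 dvd k" by (rule prime_dvd_power[OF p3])
  then obtain s where s: "k = 3 * s" by auto
  have e: "2 * s ^ 2 * n ^ 6 + 8 * s * m ^ 3 * n ^ 3 + 2 * m ^ 6 + 9 * s ^ 2 * m ^ 2 * n ^ 4 - m ^ 2 * n ^ 4
      + 3 * m ^ 4 * n ^ 2 - 9 * s ^ 2 * m ^ 4 * n ^ 2 = 0" (is "?e = 0")
  proof -
    have "9 * ?e = 2 * (k * n ^ 3 + 3 * m ^ 3) ^ 2 + 12 * m ^ 3 * n ^ 3 * k + (9 * k ^ 2 - 9) * m ^ 2 * n ^ 4
        + 3 * m ^ 4 * n ^ 2 * (9 - 3 * k ^ 2)"
      unfolding s by (simp add: algebra_simps power_numeral_reduce)
    then show ?thesis using assms(1) by simp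
  qed
  have n4: "n ^ 4 mod 3 = 1"
  proof -
    have "n ^ 4 = n ^ 2 * n ^ 2" by (simp add: power_numeral_reduce)
    then have "[n ^ 4 = 1 * 1] (mod 3)" using n2 by (simp only:) (intro cong_mult, simp_all add: cong_def)
    then show ?thesis by (simp add: cong_def)
  qed
  have s3: "3 dvd s"
  proof -
    \<comment> \<open>Modulo 3 the equation becomes a quadratic form in these monomials; running
      through the residues of \<open>s\<close>, \<open>m\<close> and the unit \<open>n\<close>
      leaves only \<open>s\<close> divisible by 3.\<close>
    define a b c where abc: "a = s * n ^ 3" "b = m ^ 3" "c = m * n ^ 2"
    have "2 * a ^ 2 + 2 * a * b + 2 * b ^ 2 - c ^ 2 = ?e + 3 * (- 2 * s * m ^ 3 * n ^ 3
        - 3 * s ^ 2 * m ^ 2 * n ^ 4 - m ^ 4 * n ^ 2 + 3 * s ^ 2 * m ^ 4 * n ^ 2)"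
      unfolding abc by (simp add: algebra_simps power_numeral_reduce)
    then have *: "(2 * a ^ 2 + 2 * a * b + 2 * b ^ 2 - c ^ 2) mod 3 = 0" unfolding e by simp
    define u v w where uvw: "u = s mod 3" "v = m mod 3" "w = n mod 3"
    have "(2 * (u * w ^ 3) ^ 2 + 2 * (u * w ^ 3) * v ^ 3 + 2 * (v ^ 3) ^ 2 - (v * w ^ 2) ^ 2) mod 3 = 0"
    proof -
      have "[u = s] (mod 3)" "[v = m] (mod 3)" "[w = n] (mod 3)" by (simp_all add: uvw cong_def)
      then have "[2 * (u * w ^ 3) ^ 2 + 2 * (u * w ^ 3) * v ^ 3 + 2 * (v ^ 3) ^ 2 - (v * w ^ 2) ^ 2
          = 2 * (s * n ^ 3) ^ 2 + 2 * (s * n ^ 3) * m ^ 3 + 2 * (m ^ 3) ^ 2 - (m * n ^ 2) ^ 2] (mod 3)"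
        by (intro cong_add cong_diff cong_mult cong_pow cong_refl)
      then show ?thesis using * unfolding abc cong_def by simp
    qed
    moreover have "u = 0 \<or> u = 1 \<or> u = 2" "v = 0 \<or> v = 1 \<or> v = 2" "w = 1 \<or> w = 2"
      using n1 unfolding uvw by presburger+
    ultimately have "u = 0" by (elim disjE) (simp_all only:, simp_all)
    then show ?thesis using uvw(1) by (metis mod_0_imp_dvd)
  qed
  then obtain s' where s': "s = 3 * s'" by auto
  \<comment> \<open>All terms but the first contain \<open>m ^ 2\<close>. Since 3 divides
    \<open>s\<close>, the cofactor is \<open>n ^ 4 - 2 * m ^ 4\<close> up to the multiple
    \<open>3 * z\<close>.\<close>
  define z where "z = - (8 * s' * m * n ^ 3) - 27 * s' ^ 2 * n ^ 4 - m ^ 2 * n ^ 2 + 27 * s' ^ 2 * m ^ 2 * n ^ 2"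
  have "2 * (s * n ^ 3) ^ 2 - m ^ 2 * (n ^ 4 - 2 * m ^ 4 + 3 * z) = ?e"
    unfolding s' z_def by (simp add: algebra_simps power_numeral_reduce)
  then have sz: "2 * (s * n ^ 3) ^ 2 = m ^ 2 * (n ^ 4 - 2 * m ^ 4 + 3 * z)" using e by simp
  have "3 dvd m"
  proof -
    have "3 dvd m ^ 2 * (n ^ 4 - 2 * m ^ 4)"
    proof -
      have "m ^ 2 * (n ^ 4 - 2 * m ^ 4) = 2 * (s * n ^ 3) ^ 2 - 3 * (m ^ 2 * z)"
        unfolding sz by (simp add: algebra_simps)
      also have "\<dots> = 3 * (6 * s' ^ 2 * n ^ 6 - m ^ 2 * z)"
        unfolding s' by (simp add: algebra_simps power_numeral_reduce)
      finally have "m ^ 2 * (n ^ 4 - 2 * m ^ 4) = 3 * (6 * s' ^ 2 * n ^ 6 - m ^ 2 * z)" .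
      then show ?thesis by simp
    qed
    then have "3 dvd m ^ 2 \<or> 3 dvd n ^ 4 - 2 * m ^ 4" using p3 prime_dvd_mult_iff by blast
    moreover have "\<not> 3 dvd n ^ 4 - 2 * m ^ 4"
    proof
      assume "3 dvd n ^ 4 - 2 * m ^ 4"
      moreover have "3 dvd x - y \<Longrightarrow> x mod 3 = 1 \<Longrightarrow> y mod 3 = 1" for x y :: int by presburger
      ultimately have "(2 * m ^ 4) mod 3 = 1" using n4 by blast
      moreover have "2 * (m ^ 2) ^ 2 = 1 ^ 2 * (2 * m ^ 4)" by (simp add: power_numeral_reduce)
      ultimately have "(1::int) = 0" using two_not_square_mod_three by blast
      then show False by simp
    qed
    ultimately show ?thesis using prime_dvd_power[OF p3] by blast
  qed
  then obtain m' where "m = 3 * m'" by auto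
  have "(n ^ 4 - 2 * m ^ 4 + 3 * z) mod 3 = 1"
  proof -
    have "n ^ 4 - 2 * m ^ 4 + 3 * z = n ^ 4 + 3 * (z - 54 * m' ^ 4)"
      using \<open>m = 3 * m'\<close> by (simp add: algebra_simps power_numeral_reduce)
    then show ?thesis by (simp only: mod_mult_self2 n4)
  qed
  with sz show ?thesis by (rule two_not_square_mod_three)
qed

text \<open>This is the residual zero at the torsion point with abscissa 3:
  \<open>X^2 + b X + a\<close> is the interpolating quadratic made monic, and \<open>lin\<close>
  says that it vanishes at \<open>3 d^2\<close>. The relation \<open>sq\<close> makes
  \<open>a / d\<close> an integer \<open>3 k\<close> with \<open>2 t + 3 = 3 k^2\<close>;
  eliminating \<open>a\<close>, \<open>b\<close>, \<open>t\<close> leaves one equation in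
  \<open>k\<close> and \<open>d = m / n\<close>.\<close>

lemma no_solution_three_adic:
  fixes a b d :: real and t :: int
  assumes "d \<in> \<rat>" "a \<in> \<rat>" "d > 0"
    and lin: "a + 3 * d ^ 2 * b + 9 * d ^ 4 = 0"
    and sq: "a ^ 2 = 3 * d ^ 2 * (2 * of_int t + 3)"
    and mid: "b ^ 2 + 2 * a = - 3 * of_int t - 3 * d ^ 2 * (3 - of_int t)"
  shows False
proof -
  have "(a / d) ^ 2 = of_int (3 * (2 * t + 3))" using sq \<open>d > 0\<close> by (simp add: power_divide field_simps)
  moreover have "a / d \<in> \<rat>" using assms by auto
  ultimately obtain j where j: "a / d = of_int j" by (metis rat_square_int)
  then have "(of_int (j ^ 2) :: real) = of_int (3 * (2 * t + 3))"
    using \<open>(a / d) ^ 2 = of_int (3 * (2 * t + 3))\<close> by simp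
  then have "j ^ 2 = 3 * (2 * t + 3)" by (simp only: of_int_eq_iff)
  then obtain k where k: "j = 3 * k" "2 * t + 3 = 3 * k ^ 2" by (rule three_dvd_of_square)
  have a: "a = 3 * d * of_int k" using j k(1) \<open>d > 0\<close> by (simp add: field_simps)
  have t: "2 * real_of_int t = 3 * of_int k ^ 2 - 3"
  proof -
    have "real_of_int (2 * t + 3) = of_int (3 * k ^ 2)" using k(2) by (simp only:)
    then show ?thesis by simp
  qed
  have "(3 * d) * (d * b) = (3 * d) * (- (of_int k + 3 * d ^ 3))"
    using lin unfolding a by (simp add: algebra_simps power_numeral_reduce)
  then have b: "d * b = - (of_int k + 3 * d ^ 3)" using \<open>d > 0\<close> by simp
  have "2 * (d * b) ^ 2 + 4 * a * d ^ 2 = - 3 * (2 * of_int t) * d ^ 2 - 3 * d ^ 4 * (6 - 2 * of_int t)"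
    using arg_cong[OF mid, of "\<lambda>x. 2 * d ^ 2 * x"] by (simp add: algebra_simps power_numeral_reduce)
  then have eq: "2 * (of_int k + 3 * d ^ 3) ^ 2 + 12 * d ^ 3 * of_int k + (9 * of_int k ^ 2 - 9) * d ^ 2
      + 3 * d ^ 4 * (9 - 3 * of_int k ^ 2) = 0"
    unfolding b a t by (simp add: algebra_simps power_numeral_reduce)
  obtain d' where "d = of_rat d'" using \<open>d \<in> \<rat>\<close> by (auto elim: Rats_cases)
  obtain m n :: int where mn: "n > 0" "d' = of_int m / of_int n" "coprime m n" by (rule rat_quotientE)
  have d: "d = of_int m / of_int n" using \<open>d = of_rat d'\<close> mn(2) by (simp add: of_rat_divide)
  define M N L where MNL: "M = real_of_int m" "N = real_of_int n" "L = real_of_int k"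
  have dN: "d * N = M" "N \<noteq> 0" using d mn(1) MNL by simp_all
  have "2 * (L * N ^ 3 + 3 * M ^ 3) ^ 2 + 12 * M ^ 3 * N ^ 3 * L + (9 * L ^ 2 - 9) * M ^ 2 * N ^ 4
      + 3 * M ^ 4 * N ^ 2 * (9 - 3 * L ^ 2) = N ^ 6 * (2 * (L + 3 * d ^ 3) ^ 2 + 12 * d ^ 3 * L + (9 * L ^ 2 - 9) * d ^ 2
      + 3 * d ^ 4 * (9 - 3 * L ^ 2))"
    unfolding dN(1)[symmetric] by (simp add: algebra_simps power_numeral_reduce)
  also have "\<dots> = 0" using eq MNL by simp
  finally have "real_of_int (2 * (k * n ^ 3 + 3 * m ^ 3) ^ 2 + 12 * m ^ 3 * n ^ 3 * k + (9 * k ^ 2 - 9) * m ^ 2 * n ^ 4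
      + 3 * m ^ 4 * n ^ 2 * (9 - 3 * k ^ 2)) = 0"
    unfolding MNL by simp
  then have "2 * (k * n ^ 3 + 3 * m ^ 3) ^ 2 + 12 * m ^ 3 * n ^ 3 * k + (9 * k ^ 2 - 9) * m ^ 2 * n ^ 4
      + 3 * m ^ 4 * n ^ 2 * (9 - 3 * k ^ 2) = 0" by (simp only: of_int_eq_0_iff)
  then have "m = 0" using mn(3) by (rule no_integer_solution_three_adic)
  then show False using d \<open>d > 0\<close> by simp
qed

section \<open>Pade approximants of a fourth root\<close>

definition v2_fact :: "nat \<Rightarrow> nat" where
  "v2_fact n = multiplicity 2 (fact n :: nat)"

definition odd_fact :: "nat \<Rightarrow> nat" where
  "odd_fact n = fact n div 2 ^ v2_fact n"

lemma fact_eq_v2_odd: "fact n = 2 ^ v2_fact n * odd_fact n"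
  unfolding v2_fact_def odd_fact_def by (simp add: multiplicity_dvd)

lemma odd_odd_fact: "odd (odd_fact n)"
  unfolding v2_fact_def odd_fact_def
  by (rule multiplicity_decompose) auto

lemma v2_fact_mono: "k \<le> n \<Longrightarrow> v2_fact k \<le> v2_fact n"
  unfolding v2_fact_def by (intro dvd_imp_multiplicity_le fact_dvd) auto

lemma fact_double: "\<exists>c. odd c \<and> fact (2 * m) = 2 ^ m * fact m * (c :: nat)"
proof (induction m)
  case 0
  show ?case by (intro exI[of _ 1]) simp
next
  case (Suc m)
  then obtain c where c: "odd c" "fact (2 * m) = 2 ^ m * fact m * (c :: nat)" by blast
  have "fact (2 * Suc m) = (2 * m + 2) * ((2 * m + 1) * fact (2 * m))"
    by (simp add: algebra_simps)
  also have "\<dots> = 2 ^ Suc m * fact (Suc m) * ((2 * m + 1) * c)"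
    unfolding c by (simp add: algebra_simps)
  finally show ?case using c(1) by (intro exI[of _ "(2 * m + 1) * c"]) auto
qed

text \<open>Passing from \<open>fact m\<close> to \<open>fact (2 * m)\<close> adds exactly
  \<open>m\<close> factors 2, and a further odd factor adds none, so the induction halves
  \<open>n\<close>. The bound limits the cost of clearing powers of 2.\<close>

lemma v2_fact_le: "v2_fact n \<le> n"
proof (induction n rule: less_induct)
  case (less n)
  have even: "v2_fact (2 * m) = m + v2_fact m" for m
  proof -
    obtain c where c: "odd c" "fact (2 * m) = 2 ^ m * fact m * (c :: nat)" using fact_double by blast
    have "c \<noteq> 0" using c(1) by (intro notI) simp
    then have "multiplicity 2 (2 ^ m * fact m * c) = multiplicity 2 (2 ^ m * fact m :: nat) + multiplicity 2 c"
      by (intro prime_elem_multiplicity_mult_distrib) auto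
    also have "multiplicity 2 (2 ^ m * fact m :: nat) = multiplicity 2 (2 ^ m :: nat) + v2_fact m"
      unfolding v2_fact_def by (intro prime_elem_multiplicity_mult_distrib) auto
    also have "multiplicity 2 c = 0" using c(1) by (rule not_dvd_imp_multiplicity_0)
    also have "multiplicity 2 (2 ^ m :: nat) = m" by (rule multiplicity_same_power) auto
    finally show ?thesis unfolding c(2)[symmetric] v2_fact_def by simp
  qed
  show ?case
  proof (cases "n = 0")
    case True
    then show ?thesis by (simp add: v2_fact_def)
  next
    case False
    define m where "m = n div 2"
    have m: "m < n" using False by (simp add: m_def)
    have "n = 2 * m \<or> n = Suc (2 * m)" unfolding m_def by presburger
    then consider "n = 2 * m" | "n = Suc (2 * m)" by blast
    then show ?thesis
    proof cases
      case 1
      then show ?thesis using even[of m] less.IH[OF m] by simp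
    next
      case 2
      have "v2_fact n = multiplicity 2 (Suc (2 * m)) + v2_fact (2 * m)"
        unfolding 2 v2_fact_def fact_Suc of_nat_id
        by (subst prime_elem_multiplicity_mult_distrib) auto
      also have "multiplicity 2 (Suc (2 * m)) = 0" by (intro not_dvd_imp_multiplicity_0) simp
      finally show ?thesis using even[of m] less.IH[OF m] 2 by simp
    qed
  qed
qed

text \<open>Modulo the odd number \<open>odd_fact k\<close> the fraction 1/4 is an integer
  \<open>N\<close>. The product becomes \<open>4 ^ k\<close> times \<open>k\<close> consecutive
  integers, and \<open>fact k\<close> divides those.\<close>

lemma odd_fact_dvd_prod:
  assumes "k \<le> n"
  shows "odd_fact k dvd (\<Prod>j<k. 4 * (n - j) + 1)"
proof -
  have "coprime (4::nat) (odd_fact k)"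
    using odd_odd_fact[of k] coprime_power_left_iff[of "2::nat" 2 "odd_fact k"] by simp
  then obtain N where N: "[4 * N = 1] (mod odd_fact k)" using cong_solve_coprime_nat by auto
  have "[(\<Prod>j<k. 4 * (n - j) + 1) = (\<Prod>j<k. 4 * (n + N - j))] (mod odd_fact k)"
  proof (rule cong_prod)
    fix j assume "j \<in> {..<k}"
    then have "4 * (n + N - j) = 4 * (n - j) + 4 * N" using assms by (simp add: algebra_simps)
    moreover have "[4 * (n - j) + 1 = 4 * (n - j) + 4 * N] (mod odd_fact k)"
      using N by (intro cong_add cong_refl) (rule cong_sym)
    ultimately show "[4 * (n - j) + 1 = 4 * (n + N - j)] (mod odd_fact k)" by simp
  qed
  moreover have "(\<Prod>j<k. 4 * (n + N - j)) = 4 ^ k * (fact k * ((n + N) choose k))"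
  proof -
    have "real (\<Prod>j<k. n + N - j) = (\<Prod>j<k. real (n + N) - real j)"
      unfolding of_nat_prod using assms by (intro prod.cong refl) (simp add: of_nat_diff)
    also have "\<dots> = fact k * (real (n + N) gchoose k)"
      by (simp add: gbinomial_mult_fact atLeast0LessThan)
    also have "\<dots> = real (fact k * ((n + N) choose k))"
      by (simp only: of_nat_mult of_nat_fact binomial_gbinomial)
    finally have "(\<Prod>j<k. n + N - j) = fact k * ((n + N) choose k)" by (simp only: of_nat_eq_iff)
    then show ?thesis by (simp add: prod.distrib)
  qed
  moreover have "odd_fact k dvd 4 ^ k * (fact k * ((n + N) choose k))"
    unfolding fact_eq_v2_odd[of k] by simp
  ultimately show ?thesis using cong_dvd_iff by auto
qed

text \<open>The binomial coefficient of \<open>n + 1/4\<close> over \<open>k\<close>, multiplied by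
  \<open>4 ^ k\<close> and by the power of 2 in \<open>fact n\<close>. The latter serves all
  \<open>k \<le> n\<close> at once and is exactly right for \<open>k = n\<close>, where the value is
  odd.\<close>

definition quarter_binom :: "nat \<Rightarrow> nat \<Rightarrow> nat" where
  "quarter_binom n k = 2 ^ (v2_fact n - v2_fact k) * ((\<Prod>j<k. 4 * (n - j) + 1) div odd_fact k)"

lemma quarter_binom_eq:
  assumes "k \<le> n"
  shows "real (quarter_binom n k) = 4 ^ k * 2 ^ v2_fact n * ((real n + 1 / 4) gchoose k)"
proof -
  define L where "L = (\<Prod>j<k. 4 * (n - j) + 1)"
  define b where "b = ((real n + 1 / 4) gchoose k)"
  have O: "odd_fact k > 0" using odd_odd_fact[of k] by (intro Nat.gr0I) auto
  have "real L = (\<Prod>j<k. 4 * (real n + 1 / 4 - real j))"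
    unfolding L_def of_nat_prod using assms by (intro prod.cong refl) (simp add: of_nat_diff)
  also have "\<dots> = 4 ^ k * (\<Prod>j<k. real n + 1 / 4 - real j)"
    by (simp only: prod.distrib prod_constant card_lessThan)
  also have "(\<Prod>j<k. real n + 1 / 4 - real j) = fact k * ((real n + 1 / 4) gchoose k)"
    by (simp add: gbinomial_mult_fact atLeast0LessThan)
  also have "fact k = (2 ^ v2_fact k * real (odd_fact k))"
    using arg_cong[OF fact_eq_v2_odd[of k], of real] by simp
  finally have L: "real L = 4 ^ k * (2 ^ v2_fact k * real (odd_fact k) * b)" unfolding b_def .
  have "real (quarter_binom n k) = 2 ^ (v2_fact n - v2_fact k) * (real L / real (odd_fact k))"
    using odd_fact_dvd_prod[OF assms] unfolding quarter_binom_def L_def[symmetric]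
    by (simp add: real_of_nat_div)
  also have "real L / real (odd_fact k) = 4 ^ k * 2 ^ v2_fact k * b"
    unfolding L using O by simp
  also have "2 ^ (v2_fact n - v2_fact k) * (4 ^ k * 2 ^ v2_fact k * b) =
      4 ^ k * (2 ^ (v2_fact n - v2_fact k) * 2 ^ v2_fact k) * b" by (simp only: mult_ac)
  also have "2 ^ (v2_fact n - v2_fact k) * 2 ^ v2_fact k = (2::real) ^ v2_fact n"
    using v2_fact_mono[OF assms] by (simp flip: power_add)
  finally show ?thesis unfolding b_def .
qed

lemma odd_quarter_binom: "odd (quarter_binom n n)"
proof -
  have "odd (\<Prod>j<k. 4 * (n - j) + 1)" for k by (induction k) auto
  moreover have "(\<Prod>j<n. 4 * (n - j) + 1) = odd_fact n * quarter_binom n n"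
    using odd_fact_dvd_prod[of n n] by (simp add: quarter_binom_def)
  ultimately show ?thesis by (metis even_mult_iff)
qed

lemma quarter_binom_le:
  assumes "k \<le> n"
  shows "quarter_binom n k \<le> 4 ^ k * 2 ^ n * (Suc n choose k)"
proof -
  have "fact k * ((real n + 1 / 4) gchoose k) \<le> fact k * (real (Suc n) gchoose k)"
    unfolding gbinomial_mult_fact using assms by (intro prod_mono) (auto simp: of_nat_diff)
  then have "((real n + 1 / 4) gchoose k) \<le> real (Suc n choose k)"
    by (simp only: binomial_gbinomial mult_le_cancel_left_pos[OF fact_gt_zero])
  moreover have "(2::real) ^ v2_fact n \<le> 2 ^ n" using v2_fact_le by simp
  moreover have "0 \<le> fact k * ((real n + 1 / 4) gchoose k)"
    unfolding gbinomial_mult_fact using assms by (intro prod_nonneg) auto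
  then have "0 \<le> ((real n + 1 / 4) gchoose k)"
    by (metis fact_gt_zero zero_le_mult_iff not_less)
  ultimately have "real (quarter_binom n k) \<le> 4 ^ k * 2 ^ n * real (Suc n choose k)"
    unfolding quarter_binom_eq[OF assms] by (intro mult_mono) auto
  then have "real (quarter_binom n k) \<le> real (4 ^ k * 2 ^ n * (Suc n choose k))" by simp
  then show ?thesis by (simp only: of_nat_le_iff)
qed

section \<open>Gaussian integers and the Pade denominators\<close>

definition gaussian_int :: "complex \<Rightarrow> bool" where
  "gaussian_int z \<longleftrightarrow> Re z \<in> \<int> \<and> Im z \<in> \<int>"

lemma gaussian_int_add: "gaussian_int z \<Longrightarrow> gaussian_int w \<Longrightarrow> gaussian_int (z + w)"
  by (simp add: gaussian_int_def)

lemma gaussian_int_mult: "gaussian_int z \<Longrightarrow> gaussian_int w \<Longrightarrow> gaussian_int (z * w)"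
  by (simp add: gaussian_int_def)

lemma gaussian_int_of_int [simp]: "gaussian_int (of_int k)"
  by (simp add: gaussian_int_def)

lemma gaussian_int_ii [simp]: "gaussian_int \<i>"
  by (simp add: gaussian_int_def)

lemma gaussian_int_power: "gaussian_int z \<Longrightarrow> gaussian_int (z ^ n)"
  by (induction n) (auto simp: gaussian_int_mult gaussian_int_def)

lemma gaussian_int_sum: "(\<And>x. x \<in> A \<Longrightarrow> gaussian_int (f x)) \<Longrightarrow> gaussian_int (sum f A)"
  by (induction A rule: infinite_finite_induct) (auto simp: gaussian_int_add gaussian_int_def)

text \<open>Twice \<open>1 + 239 \<i> = (1 - \<i>) (3 + 2 \<i>) ^ 4\<close>, the value at the known solution, is the argument of these
  denominators of the diagonal Pade approximants of the fourth root.\<close>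

definition pade :: "nat \<Rightarrow> complex" where
  "pade n = (\<Sum>k\<le>n. of_int ((-1) ^ k * int ((2 * n - k choose n) * quarter_binom n k)) * (2 + 478 * \<i>) ^ (n - k))"

text \<open>Terms with \<open>k < n\<close> contain \<open>2 + 478 * \<i>\<close>, twice a Gaussian
  integer; the term \<open>k = n\<close> is \<open>quarter_binom n n\<close> up to sign. This parity
  is the source of the nonvanishing used for the Thue equation.\<close>

lemma pade_odd:
  obtains c z where "odd c" "gaussian_int z" "pade n = of_int c + 2 * z"
proof -
  define a where "a k = (of_int ((-1) ^ k * int ((2 * n - k choose n) * quarter_binom n k)) :: complex)" for k
  have g: "gaussian_int (1 + 239 * \<i>)" by (simp add: gaussian_int_def)
  have "pade n = (\<Sum>k<n. a k * (2 + 478 * \<i>) ^ (n - k)) + a n"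
    unfolding pade_def a_def by (simp add: lessThan_Suc_atMost[symmetric] del: of_int_mult)
  also have "(\<Sum>k<n. a k * (2 + 478 * \<i>) ^ (n - k)) =
      2 * (\<Sum>k<n. a k * ((1 + 239 * \<i>) * (2 + 478 * \<i>) ^ (n - Suc k)))"
    unfolding sum_distrib_left
  proof (rule sum.cong)
    fix k assume "k \<in> {..<n}"
    then have "(2 + 478 * \<i>) ^ (n - k) = (2 + 478 * \<i>) * (2 + 478 * \<i>) ^ (n - Suc k)"
      by (metis Suc_diff_Suc lessThan_iff power_Suc)
    also have "\<dots> = 2 * ((1 + 239 * \<i>) * (2 + 478 * \<i>) ^ (n - Suc k))" by (simp add: algebra_simps)
    finally have e: "(2 + 478 * \<i>) ^ (n - k) = 2 * ((1 + 239 * \<i>) * (2 + 478 * \<i>) ^ (n - Suc k))" .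
    show "a k * (2 + 478 * \<i>) ^ (n - k) = 2 * (a k * ((1 + 239 * \<i>) * (2 + 478 * \<i>) ^ (n - Suc k)))"
      unfolding e by (simp only: mult_ac)
  qed simp
  finally have "pade n = of_int ((-1) ^ n * int (quarter_binom n n)) +
      2 * (\<Sum>k<n. a k * ((1 + 239 * \<i>) * (2 + 478 * \<i>) ^ (n - Suc k)))"
    by (simp add: a_def)
  moreover have "gaussian_int (\<Sum>k<n. a k * ((1 + 239 * \<i>) * (2 + 478 * \<i>) ^ (n - Suc k)))"
    unfolding a_def by (intro gaussian_int_sum gaussian_int_mult gaussian_int_power g gaussian_int_of_int)
      (simp add: gaussian_int_def)
  moreover have "odd ((-1) ^ n * int (quarter_binom n n))" using odd_quarter_binom by simp
  ultimately show thesis using that by blast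
qed

text \<open>The powers of 2 from both binomial factors combine to \<open>8 ^ n * 2 ^ k\<close>, and
  479 bounds the norm of \<open>2 + 478 * \<i>\<close>. The remaining sum is part of the expansion
  of \<open>(2 + 479) ^ Suc n\<close>, whence 3848 = 8 * 481.\<close>

lemma norm_pade_le: "norm (pade n) \<le> 3848 ^ n * (481 / 479)"
proof -
  have n479: "norm (2 + 478 * \<i>) \<le> 479"
    by (simp add: cmod_def) (rule real_le_lsqrt, auto)
  have "norm (pade n) \<le> (\<Sum>k\<le>n. 8 ^ n * (real (Suc n choose k) * 2 ^ k * 479 ^ (n - k)))"
    unfolding pade_def
  proof (rule sum_norm_le)
    fix k assume "k \<in> {..n}"
    then have k: "k \<le> n" by simp
    have "(2 * n - k choose n) \<le> 2 ^ (2 * n - k)" by (rule binomial_le_pow2)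
    then have "(2 * n - k choose n) * quarter_binom n k \<le> 2 ^ (2 * n - k) * (4 ^ k * 2 ^ n * (Suc n choose k))"
      using quarter_binom_le[OF k] by (intro mult_le_mono) auto
    also have "\<dots> = 8 ^ n * ((Suc n choose k) * 2 ^ k)"
    proof -
      have "(2::nat) ^ (2 * n - k) * 4 ^ k * 2 ^ n = 2 ^ (2 * n - k + 2 * k + n)"
        by (simp add: power_add power_mult)
      also have "2 * n - k + 2 * k + n = 3 * n + k" using k by simp
      also have "(2::nat) ^ (3 * n + k) = 8 ^ n * 2 ^ k" by (simp add: power_add power_mult)
      finally show ?thesis by (simp add: algebra_simps)
    qed
    finally have 1: "real ((2 * n - k choose n) * quarter_binom n k) \<le> 8 ^ n * (real (Suc n choose k) * 2 ^ k)"
      by (metis (mono_tags, lifting) of_nat_le_iff of_nat_mult of_nat_numeral of_nat_power)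
    have "norm (of_int ((-1) ^ k * int ((2 * n - k choose n) * quarter_binom n k)) * (2 + 478 * \<i>) ^ (n - k))
        = real ((2 * n - k choose n) * quarter_binom n k) * norm (2 + 478 * \<i>) ^ (n - k)"
      by (simp add: norm_mult norm_power)
    also have "\<dots> \<le> 8 ^ n * (real (Suc n choose k) * 2 ^ k) * 479 ^ (n - k)"
      using 1 n479 by (intro mult_mono power_mono) auto
    finally show "norm (of_int ((-1) ^ k * int ((2 * n - k choose n) * quarter_binom n k)) * (2 + 478 * \<i>) ^ (n - k))
        \<le> 8 ^ n * (real (Suc n choose k) * 2 ^ k * 479 ^ (n - k))" by (simp only: mult_ac)
  qed
  also have "\<dots> = 8 ^ n * (\<Sum>k\<le>n. real (Suc n choose k) * 2 ^ k * 479 ^ (n - k))"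
    by (simp only: sum_distrib_left)
  also have "(\<Sum>k\<le>n. real (Suc n choose k) * 2 ^ k * 479 ^ (n - k)) \<le> 481 ^ Suc n / 479"
  proof -
    have "479 * (\<Sum>k\<le>n. real (Suc n choose k) * 2 ^ k * 479 ^ (n - k)) =
        (\<Sum>k\<le>n. real (Suc n choose k) * 2 ^ k * 479 ^ (Suc n - k))"
      unfolding sum_distrib_left by (intro sum.cong refl) (simp add: Suc_diff_le)
    also have "\<dots> \<le> (\<Sum>k\<le>Suc n. real (Suc n choose k) * 2 ^ k * 479 ^ (Suc n - k))" by simp
    also have "\<dots> = (2 + 479) ^ Suc n" by (rule binomial_ring[symmetric])
    finally show ?thesis by (simp add: field_simps)
  qed
  finally have "norm (pade n) \<le> 8 ^ n * (481 ^ Suc n / 479)" by simp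
  also have "8 ^ n * (481 ^ Suc n / 479) = (8 ^ n * 481 ^ n) * (481 / 479 :: real)" by simp
  also have "(8 :: real) ^ n * 481 ^ n = 3848 ^ n" by (simp flip: power_mult_distrib)
  finally show ?thesis .
qed

section \<open>The approximation error as an integral, by repeated integration by parts\<close>

lemma has_field_derivative_repeated_parts:
  fixes P F :: "nat \<Rightarrow> complex \<Rightarrow> complex"
  assumes "\<And>j. (P j has_field_derivative P (Suc j) s) (at s within S)"
    and "\<And>j. (F j has_field_derivative F (Suc j) s) (at s within S)"
  shows "((\<lambda>s. \<Sum>k\<le>N. (-1) ^ k * (P (N - k) s * F k s)) has_field_derivative
    P (Suc N) s * F 0 s + (-1) ^ N * (P 0 s * F (Suc N) s)) (at s within S)"
proof -
  define b where "b k = (-1) ^ k * (P (Suc N - k) s * F k s)" for k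
  have "((\<lambda>s. \<Sum>k\<le>N. (-1) ^ k * (P (N - k) s * F k s)) has_field_derivative
      (\<Sum>k\<le>N. (-1) ^ k * (P (N - k) s * F (Suc k) s + P (Suc (N - k)) s * F k s))) (at s within S)"
    by (intro DERIV_sum DERIV_cmult DERIV_mult' assms)
  also have "(\<Sum>k\<le>N. (-1) ^ k * (P (N - k) s * F (Suc k) s + P (Suc (N - k)) s * F k s)) =
      (\<Sum>k\<le>N. b k - b (Suc k))"
    by (intro sum.cong refl) (simp add: b_def Suc_diff_le algebra_simps)
  also have "\<dots> = b 0 - b (Suc N)" by (rule sum_telescope)
  also have "\<dots> = P (Suc N) s * F 0 s + (-1) ^ N * (P 0 s * F (Suc N) s)" by (simp add: b_def)
  finally show ?thesis .
qed

lemma poly_higher_pderiv_eq_coeff: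
  fixes p :: "'a :: {comm_ring_1, semiring_no_zero_divisors, semiring_char_0} poly"
  shows "poly ((pderiv ^^ j) p) c = fact j * Polynomial.coeff (pcompose p [:c, 1:]) j"
proof -
  have "(pderiv ^^ j) (pcompose p [:c, 1:]) = pcompose ((pderiv ^^ j) p) [:c, 1:]"
    by (induction j) (simp_all add: pderiv_pcompose pderiv_pCons)
  then have "poly ((pderiv ^^ j) p) c = poly ((pderiv ^^ j) (pcompose p [:c, 1:])) 0"
    by (simp add: poly_pcompose)
  also have "\<dots> = fact j * Polynomial.coeff (pcompose p [:c, 1:]) j"
    by (simp add: poly_0_coeff_0 coeff_higher_pderiv pochhammer_fact[symmetric])
  finally show ?thesis .
qed

text \<open>\<open>(1 - s^2) ^ n\<close>. Its zeros of order \<open>n\<close> at 1 and -1 remove the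
  boundary terms with more than \<open>n\<close> derivatives of the kernel, and its degree
  \<open>2 n\<close> ends the integration by parts.\<close>

definition weight :: "nat \<Rightarrow> complex poly" where
  "weight n = [:1, 0, -1:] ^ n"

lemma pcompose_power_left: "pcompose (p ^ n) q = pcompose p q ^ n"
  by (induction n) (simp_all add: pcompose_mult pcompose_1)

lemma coeff_pX_power_mult:
  "Polynomial.coeff ([:0, 1:] ^ n * q) j = (if j < n then 0 else Polynomial.coeff q (j - n))"
  using coeff_monom_mult[of 1 n q j] by (simp add: monom_altdef)

lemma higher_pderiv_weight_at_1:
  assumes "k \<le> 2 * n"
  shows "poly ((pderiv ^^ (2 * n - k)) (weight n)) 1 =
    (-1) ^ n * (if k \<le> n then fact (2 * n - k) * of_nat (n choose k) * 2 ^ k else 0)"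
proof -
  have "pcompose (weight n) [:1, 1:] = Polynomial.smult (-1) ([:0, 1:] * [:2, 1:]) ^ n"
    unfolding weight_def by (simp add: pcompose_power_left pcompose_pCons)
  also have "\<dots> = Polynomial.smult ((-1) ^ n) ([:0, 1:] ^ n * [:2, 1:] ^ n)"
    by (simp only: smult_power power_mult_distrib)
  finally have e: "pcompose (weight n) [:1, 1:] = Polynomial.smult ((-1) ^ n) ([:0, 1:] ^ n * [:2, 1:] ^ n)" .
  show ?thesis
  proof (cases "k \<le> n")
    case True
    then have "2 * n - k - n = n - k" "\<not> 2 * n - k < n" by simp_all
    moreover have "n - (n - k) = k" "n choose (n - k) = n choose k"
      using True binomial_symmetric[of k n] by simp_all
    ultimately show ?thesis using True
      unfolding poly_higher_pderiv_eq_coeff e coeff_smult coeff_pX_power_mult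
      by (simp add: coeff_linear_poly_power)
  next
    case False
    then show ?thesis using assms
      unfolding poly_higher_pderiv_eq_coeff e coeff_smult coeff_pX_power_mult by simp
  qed
qed

lemma higher_pderiv_weight_at_minus_1:
  "poly ((pderiv ^^ j) (weight n)) (-1) = (-1) ^ j * poly ((pderiv ^^ j) (weight n)) 1"
proof -
  have "pcompose (weight n) [:0, -1:] = weight n"
    unfolding weight_def by (simp add: pcompose_power_left pcompose_pCons)
  moreover have "(pderiv ^^ j) (pcompose p [:0, -1:]) = Polynomial.smult ((-1) ^ j) (pcompose ((pderiv ^^ j) p) [:0, -1:])"
    for p :: "complex poly"
    by (induction j) (simp_all add: pderiv_pcompose pderiv_pCons pderiv_smult)
  ultimately have "(pderiv ^^ j) (weight n) = Polynomial.smult ((-1) ^ j) (pcompose ((pderiv ^^ j) (weight n)) [:0, -1:])"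
    by metis
  then have "poly ((pderiv ^^ j) (weight n)) (-1) =
      poly (Polynomial.smult ((-1) ^ j) (pcompose ((pderiv ^^ j) (weight n)) [:0, -1:])) (-1)" by simp
  then show ?thesis by (simp add: poly_pcompose)
qed

lemma higher_pderiv_weight_eq_0: "(pderiv ^^ Suc (2 * n)) (weight n) = 0"
proof (rule poly_eqI)
  fix i
  have "Polynomial.degree (weight n) \<le> Polynomial.degree [:1, 0, -1 :: complex:] * n"
    unfolding weight_def by (rule degree_power_le)
  then have "Polynomial.degree (weight n) < i + Suc (2 * n)" by simp
  then show "Polynomial.coeff ((pderiv ^^ Suc (2 * n)) (weight n)) i = Polynomial.coeff 0 i"
    unfolding coeff_higher_pderiv by (simp add: coeff_eq_0)
qed

text \<open>The \<open>m\<close>-th derivative of \<open>(239 - \<i> * s) powr (n + 1/4)\<close>.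
  For real \<open>s\<close> the base has real part 239, away from the branch cut; at the ends 1 and
  -1 it takes the conjugate values \<open>239 - \<i>\<close> and \<open>239 + \<i>\<close>.\<close>

definition kernel :: "nat \<Rightarrow> nat \<Rightarrow> complex \<Rightarrow> complex" where
  "kernel n m s = (- \<i>) ^ m * (fact m * ((of_nat n + 1 / 4) gchoose m)) * (239 - \<i> * s) powr (of_nat n + 1 / 4 - of_nat m)"

lemma kernel_derivative:
  assumes "Im s = 0"
  shows "(kernel n m has_field_derivative kernel n (Suc m) s) (at s within S)"
proof -
  define a where "a = (of_nat n + 1 / 4 :: complex)"
  have "Re (239 - \<i> * s) > 0" using assms by simp
  then have nz: "239 - \<i> * s \<notin> \<real>\<^sub>\<le>\<^sub>0" by (auto simp: complex_nonpos_Reals_iff)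
  have "((\<lambda>s. (239 - \<i> * s) powr (a - of_nat m)) has_field_derivative
      (a - of_nat m) * (239 - \<i> * s) powr (a - of_nat m - 1) * (- \<i>)) (at s within S)"
    using nz by (auto intro!: derivative_eq_intros)
  then have "((\<lambda>s. (- \<i>) ^ m * (fact m * (a gchoose m)) * (239 - \<i> * s) powr (a - of_nat m)) has_field_derivative
      (- \<i>) ^ m * (fact m * (a gchoose m)) * ((a - of_nat m) * (239 - \<i> * s) powr (a - of_nat m - 1) * (- \<i>))) (at s within S)"
    by (rule DERIV_cmult)
  then have "(kernel n m has_field_derivative
      (- \<i>) ^ m * (fact m * (a gchoose m)) * ((a - of_nat m) * (239 - \<i> * s) powr (a - of_nat m - 1) * (- \<i>))) (at s within S)"
    unfolding kernel_def[abs_def] a_def .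
  then show ?thesis
  proof (rule DERIV_cong)
    define w where "w = (239 - \<i> * s) powr (a - of_nat m - 1)"
    have "(a - of_nat m) * (a gchoose m) = of_nat (Suc m) * (a gchoose Suc m)"
      using gbinomial_mult_1[of a m] by (simp add: left_diff_distrib)
    then have f: "fact m * ((a - of_nat m) * (a gchoose m)) = fact (Suc m) * (a gchoose Suc m)"
      unfolding fact_Suc by (simp only: mult_ac)
    have "(- \<i>) ^ m * (fact m * (a gchoose m)) * ((a - of_nat m) * w * (- \<i>))
        = ((- \<i>) ^ m * (- \<i>)) * (fact m * ((a - of_nat m) * (a gchoose m))) * w" by (simp only: mult_ac)
    also have "\<dots> = (- \<i>) ^ Suc m * (fact (Suc m) * (a gchoose Suc m)) * w"
      unfolding f power_Suc2 ..
    also have "\<dots> = kernel n (Suc m) s"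
      unfolding kernel_def w_def a_def by (simp add: diff_diff_eq add.commute)
    finally show "(- \<i>) ^ m * (fact m * (a gchoose m)) * ((a - of_nat m) * (239 - \<i> * s) powr (a - of_nat m - 1) * (- \<i>))
        = kernel n (Suc m) s" unfolding w_def .
  qed
qed

text \<open>Around the middle factor 1/4 the factors pair up as \<open>j + 1/4\<close> and
  \<open>1/4 - j\<close>, each pair with product at most \<open>j^2\<close> in absolute value. One
  induction step adds the outermost pair.\<close>

lemma prod_quarter_le:
  "\<bar>\<Prod>i<Suc (2 * n). real n + 1 / 4 - real i\<bar> \<le> (fact n)\<^sup>2 / 4"
proof (induction n)
  case 0
  show ?case by simp
next
  case (Suc n)
  define q where "q = (\<Prod>i<Suc (2 * n). real n + 1 / 4 - real i)"
  define f where "f i = real (Suc n) + 1 / 4 - real i" for i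
  have "(\<Prod>i<Suc (2 * Suc n). f i) = f 0 * (\<Prod>i<Suc (2 * n). f (Suc i)) * f (Suc (Suc (2 * n)))"
    by (simp only: mult_Suc_right add_2_eq_Suc prod.lessThan_Suc[of f "Suc (Suc (2 * n))"]
      prod.lessThan_Suc_shift[of f "Suc (2 * n)"])
  also have "(\<Prod>i<Suc (2 * n). f (Suc i)) = q"
    unfolding q_def by (intro prod.cong) (simp_all add: f_def)
  finally have "\<bar>\<Prod>i<Suc (2 * Suc n). real (Suc n) + 1 / 4 - real i\<bar> =
      \<bar>f 0\<bar> * \<bar>q\<bar> * \<bar>f (Suc (Suc (2 * n)))\<bar>"
    unfolding f_def by (simp only: abs_mult)
  also have "\<dots> = \<bar>q\<bar> * ((real (Suc n) + 1 / 4) * (real (Suc n) - 1 / 4))"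
    unfolding f_def by simp
  finally have e: "\<bar>\<Prod>i<Suc (2 * Suc n). real (Suc n) + 1 / 4 - real i\<bar> =
      \<bar>q\<bar> * ((real (Suc n) + 1 / 4) * (real (Suc n) - 1 / 4))" .
  have "(real (Suc n) + 1 / 4) * (real (Suc n) - 1 / 4) \<le> (real (Suc n))\<^sup>2"
    by (simp add: power2_eq_square algebra_simps)
  then have "\<bar>q\<bar> * ((real (Suc n) + 1 / 4) * (real (Suc n) - 1 / 4)) \<le> \<bar>q\<bar> * (real (Suc n))\<^sup>2"
    by (intro mult_left_mono) auto
  also have "\<bar>q\<bar> * (real (Suc n))\<^sup>2 \<le> (fact n)\<^sup>2 / 4 * (real (Suc n))\<^sup>2"
    using Suc unfolding q_def by (intro mult_right_mono) auto
  also have "\<dots> = (fact (Suc n))\<^sup>2 / 4" by (simp add: power2_eq_square algebra_simps)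
  finally show ?case unfolding e .
qed

text \<open>60 is just below \<open>239 powr (3 / 4)\<close>, since 60^4 = 12960000 and 239^3 =
  13651919. With the factor 1/4 of the product bound it yields the 240 of the error
  estimates.\<close>

lemma powr_239_le: "(239 :: real) powr (- (real n + 3 / 4)) \<le> 1 / (60 * 239 ^ n)"
proof -
  have "(60 :: real) ^ 4 \<le> (239 powr (3 / 4)) ^ 4"
    by (simp add: powr_power)
  then have "(60 :: real) \<le> 239 powr (3 / 4)" using power_mono_iff[of "60 :: real" "239 powr (3 / 4)" 4] by simp
  then have "60 * 239 ^ n \<le> 239 powr (3 / 4) * (239 :: real) ^ n" by simp
  also have "\<dots> = 239 powr (real n + 3 / 4)"
    unfolding powr_add using powr_realpow[of 239 n] by simp
  finally have "60 * 239 ^ n \<le> (239 :: real) powr (real n + 3 / 4)" .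
  then have "inverse (239 powr (real n + 3 / 4)) \<le> inverse (60 * 239 ^ n :: real)"
    by (intro le_imp_inverse_le) auto
  then show ?thesis unfolding powr_minus by (simp only: inverse_eq_divide)
qed

definition fourth_root_h :: complex where
  "fourth_root_h = (239 - \<i>) powr (1 / 4)"

lemma fourth_root_h_power4: "fourth_root_h ^ 4 = 239 - \<i>"
proof -
  have nz: "239 - \<i> \<noteq> 0" by (simp add: complex_eq_iff)
  have "fourth_root_h ^ 4 = (239 - \<i>) powr (1 / 4 * 4)"
    using nz unfolding fourth_root_h_def by (simp add: powr_def exp_of_nat_mult[symmetric])
  then show ?thesis using nz by simp
qed

lemma norm_fourth_root_h: "norm fourth_root_h \<le> 4"
proof -
  have "norm fourth_root_h ^ 8 = (norm (239 - \<i>)) ^ 2"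
    unfolding fourth_root_h_power4[symmetric] norm_power by (simp flip: power_mult)
  also have "\<dots> \<le> 4 ^ 8" by (simp add: cmod_power2)
  finally show ?thesis using power_mono_iff[of "norm fourth_root_h" 4 8] by simp
qed

text \<open>A primitive of \<open>weight n\<close> times the derivative of order
  \<open>2 n + 1\<close> of the fractional power. Its difference between 1 and -1 is the Pade
  remainder integral, small because of that high derivative.\<close>

definition antiderivative :: "nat \<Rightarrow> complex \<Rightarrow> complex" where
  "antiderivative n s = (\<Sum>k\<le>2 * n. (-1) ^ k * (poly ((pderiv ^^ (2 * n - k)) (weight n)) s * kernel n k s))"

lemma kernel_at_1:
  assumes "k \<le> n"
  shows "kernel n k 1 = (- \<i>) ^ k * (fact k * ((of_nat n + 1 / 4) gchoose k)) * (fourth_root_h * (239 - \<i>) ^ (n - k))"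
proof -
  have "(239 - \<i>) powr (of_nat n + 1 / 4 - of_nat k) = (239 - \<i>) powr (1 / 4 + of_nat (n - k))"
    using assms by (simp add: of_nat_diff algebra_simps)
  also have "\<dots> = fourth_root_h * (239 - \<i>) ^ (n - k)"
    unfolding powr_add fourth_root_h_def by (subst powr_complexpow) (simp_all add: complex_eq_iff)
  finally show ?thesis unfolding kernel_def by simp
qed

lemma kernel_at_minus_1: "kernel n k (-1) = (-1) ^ k * cnj (kernel n k 1)"
proof -
  define b where "b = ((real n + 1 / 4) gchoose k)"
  have b: "((of_nat n + 1 / 4) gchoose k) = complex_of_real b"
    unfolding b_def by (simp add: gbinomial_prod_rev)
  have "cnj ((239 - \<i>) powr (of_nat n + 1 / 4 - of_nat k)) = cnj (239 - \<i>) powr cnj (of_nat n + 1 / 4 - of_nat k)"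
    by (rule cnj_powr) simp
  then have "cnj ((239 - \<i>) powr (of_nat n + 1 / 4 - of_nat k)) = (239 + \<i>) powr (of_nat n + 1 / 4 - of_nat k)"
    by simp
  moreover have "(-1) ^ k * \<i> ^ k = (- \<i>) ^ k" by (simp flip: power_mult_distrib)
  ultimately show ?thesis unfolding kernel_def b by simp
qed

lemma antiderivative_at_minus_1: "antiderivative n (-1) = cnj (antiderivative n 1)"
  unfolding antiderivative_def cnj_sum
proof (rule sum.cong)
  fix k assume "k \<in> {..2 * n}"
  then have k: "k \<le> 2 * n" by simp
  have "cnj (poly ((pderiv ^^ (2 * n - k)) (weight n)) 1) = poly ((pderiv ^^ (2 * n - k)) (weight n)) 1"
    unfolding higher_pderiv_weight_at_1[OF k] by simp
  moreover have "(-1 :: complex) ^ (2 * n - k) = (-1) ^ k"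
    using k by (simp add: minus_one_power_iff)
  moreover have "(-1 :: complex) ^ k * (-1) ^ k = 1" by (simp flip: power_add)
  ultimately show "(-1) ^ k * (poly ((pderiv ^^ (2 * n - k)) (weight n)) (-1) * kernel n k (-1)) =
      cnj ((-1) ^ k * (poly ((pderiv ^^ (2 * n - k)) (weight n)) 1 * kernel n k 1))"
    unfolding higher_pderiv_weight_at_minus_1 kernel_at_minus_1 by simp
qed simp

text \<open>The boundary terms that survive, \<open>k \<le> n\<close>, are those of
  \<open>pade n\<close> one by one: the factorials and the binomial coefficient of the weight leave
  \<open>fact n\<close> squared, and \<open>2 + 478 * \<i> = 2 * \<i> * (239 - \<i>)\<close>
  converts the powers of the base.\<close>

lemma antiderivative_at_1:
  "4 ^ n * 2 ^ v2_fact n * antiderivative n 1 = (fact n)\<^sup>2 * 2 ^ n * (fourth_root_h * \<i> ^ n * pade n)"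
proof -
  have "antiderivative n 1 = (\<Sum>k\<le>n. (-1) ^ k * (poly ((pderiv ^^ (2 * n - k)) (weight n)) 1 * kernel n k 1))"
    unfolding antiderivative_def
    by (intro sum.mono_neutral_right) (auto simp: higher_pderiv_weight_at_1)
  then have "4 ^ n * 2 ^ v2_fact n * antiderivative n 1 = (\<Sum>k\<le>n. 4 ^ n * 2 ^ v2_fact n *
      ((-1) ^ k * (poly ((pderiv ^^ (2 * n - k)) (weight n)) 1 * kernel n k 1)))"
    by (simp only: sum_distrib_left)
  also have "\<dots> = (\<Sum>k\<le>n. (fact n)\<^sup>2 * 2 ^ n * (fourth_root_h * \<i> ^ n) *
      (of_int ((-1) ^ k * int ((2 * n - k choose n) * quarter_binom n k)) * (2 + 478 * \<i>) ^ (n - k)))"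
  proof (rule sum.cong)
    fix k assume "k \<in> {..n}"
    then have k: "k \<le> n" by simp
    define b where "b = ((real n + 1 / 4) gchoose k)"
    have b: "((of_nat n + 1 / 4) gchoose k) = complex_of_real b"
      unfolding b_def by (simp add: gbinomial_prod_rev)
    have "complex_of_real (real (quarter_binom n k)) = of_real (4 ^ k * 2 ^ v2_fact n * b)"
      unfolding b_def quarter_binom_eq[OF k] ..
    then have qb: "of_nat (quarter_binom n k) = 4 ^ k * 2 ^ v2_fact n * complex_of_real b" by simp
    have "fact (2 * n - k) * (n choose k) * fact k = (2 * n - k choose n) * (fact n * fact n)"
    proof -
      have "fact n * fact (2 * n - k - n) * (2 * n - k choose n) = fact (2 * n - k)"
        using k by (intro binomial_fact_lemma) simp
      moreover have "2 * n - k - n = n - k" by simp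
      ultimately have 1: "fact (2 * n - k) = fact n * fact (n - k) * (2 * n - k choose n)" by simp
      have "fact k * fact (n - k) * (n choose k) = fact n" using k by (rule binomial_fact_lemma)
      moreover have "fact n * fact (n - k) * (2 * n - k choose n) * (n choose k) * fact k =
          (2 * n - k choose n) * (fact n * (fact k * fact (n - k) * (n choose k)))" by (simp only: mult_ac)
      ultimately show ?thesis unfolding 1 by simp
    qed
    then have "of_nat (fact (2 * n - k) * (n choose k) * fact k) = (of_nat ((2 * n - k choose n) * (fact n * fact n)) :: complex)"
      by simp
    then have f: "fact (2 * n - k) * of_nat (n choose k) * fact k = of_nat (2 * n - k choose n) * (fact n * fact n :: complex)"
      by simp
    have "(-1) * 4 * (239 - \<i>) = (2 * \<i>) * (2 + 478 * \<i>)" by (simp add: algebra_simps)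
    from arg_cong[OF this, of "\<lambda>z. z ^ (n - k)"]
    have h: "(-1) ^ (n - k) * 4 ^ (n - k) * (239 - \<i>) ^ (n - k) = (2 * \<i>) ^ (n - k) * (2 + 478 * \<i>) ^ (n - k)"
      by (simp only: power_mult_distrib)
    have p: "poly ((pderiv ^^ (2 * n - k)) (weight n)) 1 = (-1) ^ n * (fact (2 * n - k) * of_nat (n choose k) * 2 ^ k)"
      using higher_pderiv_weight_at_1[of k n] k by simp
    have oi: "(of_int ((-1) ^ k * int ((2 * n - k choose n) * quarter_binom n k)) :: complex) =
        (-1) ^ k * (of_nat (2 * n - k choose n) * of_nat (quarter_binom n k))" by simp
    have n4: "(4 :: complex) ^ n = 4 ^ k * 4 ^ (n - k)" using k by (simp flip: power_add)
    have n1: "(-1 :: complex) ^ n = (-1) ^ k * (-1) ^ (n - k)" using k by (simp flip: power_add)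
    have nk: "(-1 :: complex) ^ k * (-1) ^ k = 1" by (simp flip: power_add)
    have "(- \<i> * 2) ^ k = (- 1 * (2 * \<i>)) ^ k" by (simp add: mult.commute)
    then have ni: "(- \<i>) ^ k * 2 ^ k = (-1) ^ k * (2 * \<i>) ^ k" by (simp only: power_mult_distrib)
    have "(2 * \<i>) ^ k * (2 * \<i>) ^ (n - k) = (2 * \<i>) ^ n"
      using k by (simp only: power_add[symmetric] le_add_diff_inverse)
    then have ni2: "(2 * \<i>) ^ k * (2 * \<i>) ^ (n - k) = 2 ^ n * \<i> ^ n" by (simp only: power_mult_distrib)
    have "4 ^ n * 2 ^ v2_fact n * ((-1) ^ k * (poly ((pderiv ^^ (2 * n - k)) (weight n)) 1 * kernel n k 1)) =
        (4 ^ k * 2 ^ v2_fact n * of_real b) * ((-1) ^ k * (-1) ^ k) * ((- \<i>) ^ k * 2 ^ k)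
        * (fact (2 * n - k) * of_nat (n choose k) * fact k) * fourth_root_h
        * ((-1) ^ (n - k) * 4 ^ (n - k) * (239 - \<i>) ^ (n - k))"
      unfolding kernel_at_1[OF k] b p n4 n1 by (simp only: mult_ac)
    also have "\<dots> = of_nat (quarter_binom n k) * ((-1) ^ k * (2 * \<i>) ^ k) * (of_nat (2 * n - k choose n) * (fact n * fact n))
        * fourth_root_h * ((2 * \<i>) ^ (n - k) * (2 + 478 * \<i>) ^ (n - k))"
      unfolding f h ni nk qb mult_1_right ..
    also have "\<dots> = of_nat (quarter_binom n k) * (-1) ^ k * (of_nat (2 * n - k choose n) * (fact n * fact n))
        * fourth_root_h * (((2 * \<i>) ^ k * (2 * \<i>) ^ (n - k)) * (2 + 478 * \<i>) ^ (n - k))"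
      by (simp only: mult_ac)
    also have "\<dots> = (fact n)\<^sup>2 * 2 ^ n * (fourth_root_h * \<i> ^ n) *
        (of_int ((-1) ^ k * int ((2 * n - k choose n) * quarter_binom n k)) * (2 + 478 * \<i>) ^ (n - k))"
      unfolding ni2 oi power2_eq_square by (simp only: mult_ac)
    finally show "4 ^ n * 2 ^ v2_fact n * ((-1) ^ k * (poly ((pderiv ^^ (2 * n - k)) (weight n)) 1 * kernel n k 1)) =
        (fact n)\<^sup>2 * 2 ^ n * (fourth_root_h * \<i> ^ n) *
        (of_int ((-1) ^ k * int ((2 * n - k choose n) * quarter_binom n k)) * (2 + 478 * \<i>) ^ (n - k))" .
  qed simp
  also have "\<dots> = (fact n)\<^sup>2 * 2 ^ n * (fourth_root_h * \<i> ^ n) * pade n"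
    unfolding pade_def by (simp only: sum_distrib_left)
  finally show ?thesis by (simp only: mult_ac)
qed

text \<open>The mean value inequality on the segment stands in for an integral. There the weight has
  norm at most 1, the exponents contribute at most a quarter of \<open>fact n\<close> squared, and
  the power at most \<open>1 / (60 * 239 ^ n)\<close>; the final 2 is the length of the
  segment.\<close>

lemma antiderivative_difference_le:
  "norm (antiderivative n 1 - antiderivative n (-1)) \<le> (fact n)\<^sup>2 / (240 * 239 ^ n) * 2"
proof -
  define C where "C = closed_segment (-1) (1 :: complex)"
  have C: "\<exists>x. s = complex_of_real x \<and> \<bar>x\<bar> \<le> 1" if "s \<in> C" for s
  proof -
    from that obtain u where u: "0 \<le> u" "u \<le> 1" "s = (1 - u) *\<^sub>R (-1) + u *\<^sub>R 1"
      unfolding C_def closed_segment_def by auto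
    then have "s = complex_of_real (2 * u - 1)" by (simp add: scaleR_conv_of_real)
    then show ?thesis using u by (intro exI[of _ "2 * u - 1"]) auto
  qed
  have "norm (antiderivative n 1 - antiderivative n (-1)) \<le> (fact n)\<^sup>2 / (240 * 239 ^ n) * norm (1 - (-1) :: complex)"
  proof (rule field_differentiable_bound[of C _ "\<lambda>s. poly (weight n) s * kernel n (Suc (2 * n)) s"])
    show "convex C" "1 \<in> C" "-1 \<in> C" by (simp_all add: C_def)
    fix s assume "s \<in> C"
    then obtain x where x: "s = complex_of_real x" "\<bar>x\<bar> \<le> 1" using C by blast
    have "((\<lambda>s. \<Sum>k\<le>2 * n. (-1) ^ k * (poly ((pderiv ^^ (2 * n - k)) (weight n)) s * kernel n k s)) has_field_derivative
        poly ((pderiv ^^ Suc (2 * n)) (weight n)) s * kernel n 0 s +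
        (-1) ^ (2 * n) * (poly ((pderiv ^^ 0) (weight n)) s * kernel n (Suc (2 * n)) s)) (at s within C)"
    proof (rule has_field_derivative_repeated_parts[where P = "\<lambda>j. poly ((pderiv ^^ j) (weight n))"])
      show "(poly ((pderiv ^^ j) (weight n)) has_field_derivative poly ((pderiv ^^ Suc j) (weight n)) s) (at s within C)" for j
        unfolding funpow.simps comp_def by (intro DERIV_subset[OF poly_DERIV]) simp
      show "(kernel n j has_field_derivative kernel n (Suc j) s) (at s within C)" for j
        by (rule kernel_derivative) (simp add: x)
    qed
    then show "(antiderivative n has_field_derivative poly (weight n) s * kernel n (Suc (2 * n)) s) (at s within C)"
      unfolding antiderivative_def[abs_def] higher_pderiv_weight_eq_0 by simp
    have "x ^ 2 \<le> 1" using x(2) by (simp add: abs_square_le_1)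
    have "poly (weight n) s = complex_of_real ((1 - x ^ 2) ^ n)"
      unfolding weight_def x by (simp add: power2_eq_square)
    then have "norm (poly (weight n) s) = (1 - x ^ 2) ^ n"
      using \<open>x ^ 2 \<le> 1\<close> by (simp only: norm_of_real) simp
    then have w: "norm (poly (weight n) s) \<le> 1" using \<open>x ^ 2 \<le> 1\<close> by (simp add: power_le_one)
    define b where "b = ((real n + 1 / 4) gchoose Suc (2 * n))"
    have b: "((of_nat n + 1 / 4) gchoose Suc (2 * n)) = complex_of_real b"
      unfolding b_def by (simp add: gbinomial_prod_rev)
    have "\<bar>fact (Suc (2 * n)) * b\<bar> \<le> (fact n)\<^sup>2 / 4"
      unfolding b_def gbinomial_mult_fact using prod_quarter_le[of n] by (simp only: atLeast0LessThan)
    moreover have "norm ((239 - \<i> * s) powr (of_nat n + 1 / 4 - of_nat (Suc (2 * n)))) \<le> 1 / (60 * 239 ^ n)"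
    proof -
      have e: "(of_nat n + 1 / 4 - of_nat (Suc (2 * n)) :: complex) = of_real (- (real n + 3 / 4))" by simp
      have "239 = \<bar>Re (239 - \<i> * s)\<bar>" by (simp add: x)
      also have "\<dots> \<le> norm (239 - \<i> * s)" by (rule abs_Re_le_cmod)
      finally have "norm (239 - \<i> * s) powr (- (real n + 3 / 4)) \<le> 239 powr (- (real n + 3 / 4))"
        by (intro powr_mono2') auto
      then show ?thesis unfolding e using powr_239_le[of n] by (simp add: norm_powr_real_powr')
    qed
    ultimately have "\<bar>fact (Suc (2 * n)) * b\<bar> * norm ((239 - \<i> * s) powr (of_nat n + 1 / 4 - of_nat (Suc (2 * n))))
        \<le> (fact n)\<^sup>2 / 4 * (1 / (60 * 239 ^ n))" by (intro mult_mono) auto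
    moreover have "norm (kernel n (Suc (2 * n)) s) =
        \<bar>fact (Suc (2 * n)) * b\<bar> * norm ((239 - \<i> * s) powr (of_nat n + 1 / 4 - of_nat (Suc (2 * n))))"
      unfolding kernel_def b by (simp only: norm_mult norm_power norm_minus_cancel norm_ii power_one mult_1
        norm_of_real norm_fact abs_mult abs_of_nonneg[OF fact_ge_zero])
    ultimately have "norm (kernel n (Suc (2 * n)) s) \<le> (fact n)\<^sup>2 / (240 * 239 ^ n)" by simp
    then show "norm (poly (weight n) s * kernel n (Suc (2 * n)) s) \<le> (fact n)\<^sup>2 / (240 * 239 ^ n)"
      unfolding norm_mult using w by (metis mult_mono norm_ge_zero mult_1 zero_le_one order_trans)
  qed
  then show ?thesis by simp
qed

text \<open>The end values are conjugate, so their difference is \<open>2 * \<i>\<close> times an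
  imaginary part. In the conversion factor \<open>v2_fact_le\<close> lets \<open>2 ^ n\<close>
  absorb the power of 2 from \<open>fact n\<close>, leaving \<open>4 ^ n\<close>.\<close>

lemma Im_pade_le: "\<bar>Im (fourth_root_h * \<i> ^ n * pade n)\<bar> \<le> (4 / 239) ^ n / 240"
proof -
  define z where "z = fourth_root_h * \<i> ^ n * pade n"
  define c where "c = (fact n)\<^sup>2 * 2 ^ n / (4 ^ n * 2 ^ v2_fact n :: real)"
  have "antiderivative n 1 = of_real c * z"
    using antiderivative_at_1[of n] unfolding z_def c_def by (simp add: field_simps)
  then have "antiderivative n 1 - antiderivative n (-1) = 2 * of_real (c * Im z) * \<i>"
    unfolding antiderivative_at_minus_1 by (simp add: complex_eq_iff)
  then have "2 * \<bar>c * Im z\<bar> \<le> (fact n)\<^sup>2 / (240 * 239 ^ n) * 2"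
    using antiderivative_difference_le[of n] by (simp add: norm_mult abs_mult)
  moreover have "c > 0" by (simp add: c_def)
  ultimately have "c * \<bar>Im z\<bar> \<le> (fact n)\<^sup>2 / (240 * 239 ^ n)" by (simp add: abs_mult)
  also have "\<dots> = c * ((4 ^ n * 2 ^ v2_fact n / 2 ^ n) / (240 * 239 ^ n))" by (simp add: c_def)
  finally have "\<bar>Im z\<bar> \<le> (4 ^ n * 2 ^ v2_fact n / 2 ^ n) / (240 * 239 ^ n)"
    using \<open>c > 0\<close> by (simp only: mult_le_cancel_left_pos)
  also have "\<dots> \<le> 4 ^ n / (240 * 239 ^ n)"
    using v2_fact_le[of n] by (intro divide_right_mono) (auto simp: divide_simps)
  also have "\<dots> = (4 / 239) ^ n / 240" by (simp add: power_divide)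
  finally show ?thesis unfolding z_def .
qed

section \<open>Ljunggren's equation\<close>

lemma rotate_into_sector:
  fixes w :: complex
  assumes "w \<noteq> 0"
  obtains j where "Re (\<i> ^ j * w) > 0" "\<bar>Im (\<i> ^ j * w)\<bar> \<le> Re (\<i> ^ j * w)"
proof -
  have "\<i> ^ 2 = -1" "\<i> ^ 3 = - \<i>" by (simp_all add: power2_eq_square power3_eq_cube)
  then have i: "\<i> ^ 0 * w = w" "\<i> ^ 1 * w = \<i> * w" "\<i> ^ 2 * w = - w" "\<i> ^ 3 * w = - (\<i> * w)" by simp_all
  have "Re w \<noteq> 0 \<or> Im w \<noteq> 0" using assms by (simp add: complex_eq_iff)
  then consider "Re w > 0" "\<bar>Im w\<bar> \<le> Re w" | "Re w < 0" "\<bar>Im w\<bar> \<le> - Re w"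
    | "Im w < 0" "\<bar>Re w\<bar> \<le> - Im w" | "Im w > 0" "\<bar>Re w\<bar> \<le> Im w" by linarith
  then show thesis
  proof cases
    case 1 then show thesis using that[of 0] by (simp only: i)
  next
    case 2 then show thesis using that[of 2] by (simp add: i)
  next
    case 3 then show thesis using that[of 1] by (simp only: i) simp
  next
    case 4 then show thesis using that[of 3] by (simp add: i)
  qed
qed

text \<open>With \<open>x = Re w\<close> and \<open>y = \<bar>Im w\<bar>\<close> the imaginary part
  of \<open>w ^ 4\<close> has size \<open>4 x y (x^2 - y^2)\<close>. The positive real part keeps
  \<open>w\<close> away from the diagonals, \<open>5 y^2 < x^2\<close>, so \<open>y\<close> is at
  most of order \<open>x^-3\<close>.\<close>

lemma sector_Im_le:
  fixes w :: complex
  assumes "Re w > 0" "\<bar>Im w\<bar> \<le> Re w" "Re (w ^ 4) > 0" "\<bar>Im (w ^ 4)\<bar> \<le> 4"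
  shows "\<bar>Im w\<bar> * Re w ^ 3 \<le> 5 / 4"
proof -
  define x y where "x = Re w" and "y = \<bar>Im w\<bar>"
  have y: "y ^ 2 = (Im w) ^ 2" by (simp add: y_def)
  have w2: "w ^ 4 = (w * w) * (w * w)" by (simp add: power_numeral_reduce)
  have "Re (w ^ 4) = (x ^ 2) ^ 2 - 6 * (x ^ 2 * y ^ 2) + y ^ 2 * y ^ 2"
    unfolding w2 y by (simp add: x_def power2_eq_square algebra_simps)
  moreover have "Im (w ^ 4) = 4 * x * Im w * (x ^ 2 - y ^ 2)"
    unfolding w2 y by (simp add: x_def power2_eq_square algebra_simps)
  moreover have "y ^ 2 \<le> x ^ 2" unfolding x_def y_def using assms(2) by (intro power_mono) auto
  moreover have "y ^ 2 * y ^ 2 \<le> x ^ 2 * y ^ 2" using \<open>y ^ 2 \<le> x ^ 2\<close> by (intro mult_right_mono) auto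
  ultimately have "0 < x ^ 2 * (x ^ 2 - 5 * y ^ 2)"
    using assms(3) by (simp add: power2_eq_square algebra_simps)
  then have "5 * y ^ 2 < x ^ 2" using assms(1) by (simp add: x_def zero_less_mult_iff)
  then have "x ^ 2 - y ^ 2 \<ge> 4 / 5 * x ^ 2" by simp
  then have "4 * x * y * (4 / 5 * x ^ 2) \<le> 4 * x * y * (x ^ 2 - y ^ 2)"
    using assms(1) by (intro mult_left_mono) (auto simp: x_def y_def)
  also have "\<dots> = \<bar>Im (w ^ 4)\<bar>"
    using \<open>Im (w ^ 4) = _\<close> \<open>y ^ 2 \<le> x ^ 2\<close> assms(1) by (simp add: abs_mult x_def y_def)
  also have "\<dots> \<le> 4" by fact
  finally show ?thesis unfolding x_def y_def by (simp add: power2_eq_square power3_eq_cube mult_ac)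
qed

text \<open>Since \<open>pade n\<close> is odd up to twice a Gaussian integer, the imaginary part
  has the parity of that of \<open>W * \<i> ^ n\<close>: the parity of \<open>b\<close> for even
  \<open>n\<close>, of \<open>a\<close> for odd \<open>n\<close>. One of two consecutive indices
  therefore gives an odd, hence nonzero, integer.\<close>

lemma odd_linear_form:
  fixes a b :: int
  assumes "cnj \<xi> * (3 + 2 * \<i>) = of_int a + of_int b * \<i>" "odd a \<or> odd b"
  obtains n where "n = m \<or> n = Suc m" "\<bar>Im (cnj \<xi> * (3 + 2 * \<i>) * \<i> ^ n * pade n)\<bar> \<ge> 1"
proof -
  define W where "W = (of_int a + of_int b * \<i> :: complex)"
  define n where "n = (if even m = odd b then m else Suc m)"
  have n: "n = m \<or> n = Suc m" "even n = odd b" by (auto simp: n_def)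
  obtain k where k: "odd k" "Im (W * \<i> ^ n) = of_int k"
  proof (cases "even n")
    case True
    then obtain l where "n = 2 * l" by blast
    then have "\<i> ^ n = (-1) ^ l" by (simp add: power_mult)
    then have "\<i> ^ n = 1 \<or> \<i> ^ n = -1" by (cases "even l") simp_all
    then have "Im (W * \<i> ^ n) = of_int b \<or> Im (W * \<i> ^ n) = of_int (- b)"
      unfolding W_def by (elim disjE) simp_all
    moreover have "odd b" "odd (- b)" using n(2) True by simp_all
    ultimately show thesis using that by blast
  next
    case False
    then obtain l where "n = 2 * l + 1" by (rule oddE)
    then have "\<i> ^ n = (-1) ^ l * \<i>" by (simp add: power_mult)
    then have "\<i> ^ n = \<i> \<or> \<i> ^ n = - \<i>" by (cases "even l") simp_all
    then have "Im (W * \<i> ^ n) = of_int a \<or> Im (W * \<i> ^ n) = of_int (- a)"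
      unfolding W_def by (elim disjE) simp_all
    moreover have "odd a" "odd (- a)" using n(2) False assms(2) by simp_all
    ultimately show thesis using that by blast
  qed
  obtain c z where cz: "odd c" "gaussian_int z" "pade n = of_int c + 2 * z" by (rule pade_odd)
  have "gaussian_int (W * \<i> ^ n * z)"
    unfolding W_def using cz(2)
    by (intro gaussian_int_mult gaussian_int_add gaussian_int_power gaussian_int_of_int gaussian_int_ii)
  then obtain l where l: "Im (W * \<i> ^ n * z) = of_int l" unfolding gaussian_int_def by (auto elim: Ints_cases)
  have "W * \<i> ^ n * pade n = of_real (of_int c) * (W * \<i> ^ n) + of_real 2 * (W * \<i> ^ n * z)"
    unfolding cz(3) by (simp add: algebra_simps)
  then have "Im (W * \<i> ^ n * pade n) = of_int c * Im (W * \<i> ^ n) + 2 * Im (W * \<i> ^ n * z)"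
    by (simp only: plus_complex.sel times_complex.sel Re_complex_of_real Im_complex_of_real)
  also have "\<dots> = of_int (c * k + 2 * l)" using k l by simp
  finally have e: "Im (W * \<i> ^ n * pade n) = of_int (c * k + 2 * l)" .
  have "odd (c * k + 2 * l)" using cz(1) k(1) by simp
  then have "c * k + 2 * l \<noteq> 0" by (metis even_zero)
  then have "\<bar>Im (W * \<i> ^ n * pade n)\<bar> \<ge> 1" unfolding e by linarith
  then show thesis using that n(1) unfolding assms(1) W_def by blast
qed

text \<open>A fourth root of \<open>- (1 + \<i>)\<close> expressed by the known solution:
  \<open>239 - \<i> = - (1 + \<i>) * (3 + 2 * \<i>) ^ 4\<close>. Multiplying
  \<open>u + v \<i>\<close> by it turns the Thue form into minus the imaginary part of a fourth
  power.\<close>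

definition rho :: complex where
  "rho = fourth_root_h / (3 + 2 * \<i>)"

lemma rho_power4: "rho ^ 4 = - (1 + \<i>)"
proof -
  have "(3 + 2 * \<i>) ^ 4 = -119 + 120 * \<i>"
    by (simp add: power_numeral_reduce algebra_simps)
  moreover have "- (1 + \<i>) * (-119 + 120 * \<i>) = 239 - \<i>" by (simp add: algebra_simps)
  moreover have "-119 + 120 * \<i> \<noteq> 0" by (simp add: complex_eq_iff)
  ultimately show ?thesis
    unfolding rho_def power_divide fourth_root_h_power4 by (metis nonzero_mult_div_cancel_right)
qed

lemma norm_rho_ge: "norm rho \<ge> 1"
proof -
  have "norm rho ^ 4 = sqrt 2"
    unfolding norm_power[symmetric] rho_power4 by (simp add: cmod_def)
  also have "sqrt 2 \<ge> 1 ^ 4" by simp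
  finally show ?thesis using power_mono_iff[of 1 "norm rho" 4] by simp
qed

text \<open>For \<open>w = rho * \<xi>\<close> the product \<open>cnj w * L\<close> is the given
  form times \<open>norm rho\<close> squared. Its imaginary part consists of two cross products:
  large \<open>Re w\<close> against tiny \<open>Im L\<close>, and tiny \<open>Im w\<close> against
  large \<open>Re L\<close>.\<close>

lemma linear_form_le:
  assumes "Re (rho * \<xi>) > 0"
  shows "\<bar>Im (cnj \<xi> * (3 + 2 * \<i>) * \<i> ^ n * pade n)\<bar>
    \<le> Re (rho * \<xi>) * ((4 / 239) ^ n / 240) + \<bar>Im (rho * \<xi>)\<bar> * (5 * 3848 ^ n)"
proof -
  define T where "T = Im (cnj \<xi> * (3 + 2 * \<i>) * \<i> ^ n * pade n)"
  define L where "L = fourth_root_h * \<i> ^ n * pade n"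
  define w where "w = rho * \<xi>"
  have "fourth_root_h = rho * (3 + 2 * \<i>)" unfolding rho_def by (simp add: complex_eq_iff)
  then have "cnj w * L = (rho * cnj rho) * (cnj \<xi> * (3 + 2 * \<i>) * \<i> ^ n * pade n)"
    unfolding w_def L_def by (simp add: mult_ac)
  then have "cnj w * L = of_real ((norm rho) ^ 2) * (cnj \<xi> * (3 + 2 * \<i>) * \<i> ^ n * pade n)"
    by (simp only: complex_norm_square)
  then have "Im (cnj w * L) = (norm rho) ^ 2 * T" unfolding T_def by simp
  then have "\<bar>Im (cnj w * L)\<bar> = (norm rho) ^ 2 * \<bar>T\<bar>" by (simp add: abs_mult)
  moreover have "(norm rho) ^ 2 \<ge> 1" using norm_rho_ge by (simp add: one_le_power)
  ultimately have "\<bar>T\<bar> \<le> \<bar>Im (cnj w * L)\<bar>" using mult_right_mono[of 1 "(norm rho) ^ 2" "\<bar>T\<bar>"] by simp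
  also have "\<dots> \<le> \<bar>Re w\<bar> * \<bar>Im L\<bar> + \<bar>Im w\<bar> * \<bar>Re L\<bar>" by (simp flip: abs_mult)
  also have "\<dots> \<le> Re w * ((4 / 239) ^ n / 240) + \<bar>Im w\<bar> * (5 * 3848 ^ n)"
  proof (rule add_mono)
    show "\<bar>Re w\<bar> * \<bar>Im L\<bar> \<le> Re w * ((4 / 239) ^ n / 240)"
      using Im_pade_le[of n] assms unfolding L_def w_def by (simp add: mult_left_mono)
    have "\<bar>Re L\<bar> \<le> norm L" by (rule abs_Re_le_cmod)
    also have "\<dots> = norm fourth_root_h * norm (pade n)" unfolding L_def by (simp add: norm_mult norm_power)
    also have "\<dots> \<le> 4 * (3848 ^ n * (481 / 479))"
      using norm_fourth_root_h norm_pade_le by (intro mult_mono) auto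
    also have "\<dots> \<le> 5 * 3848 ^ n" by simp
    finally show "\<bar>Im w\<bar> * \<bar>Re L\<bar> \<le> \<bar>Im w\<bar> * (5 * 3848 ^ n)" by (intro mult_left_mono) auto
  qed
  finally show ?thesis unfolding T_def w_def .
qed

lemma sector_Re_le:
  fixes a b :: int
  assumes W: "cnj \<xi> * (3 + 2 * \<i>) = of_int a + of_int b * \<i>" "odd a \<or> odd b"
    and sector: "Re (rho * \<xi>) > 0" "\<bar>Im (rho * \<xi>)\<bar> \<le> Re (rho * \<xi>)"
    and p4: "Re ((rho * \<xi>) ^ 4) > 0" "\<bar>Im ((rho * \<xi>) ^ 4)\<bar> \<le> 4"
  shows "Re (rho * \<xi>) \<le> 1400000"
proof (rule ccontr)
  define x y where "x = Re (rho * \<xi>)" and "y = \<bar>Im (rho * \<xi>)\<bar>"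
  assume "\<not> Re (rho * \<xi>) \<le> 1400000"
  then have x: "x > 1400000" by (simp add: x_def)
  have y: "y * x ^ 3 \<le> 5 / 4" unfolding x_def y_def by (rule sector_Im_le[OF sector p4])
  \<comment> \<open>The threshold 120 makes the first term of the linear form at most 1/2, so the
    second must supply the other 1/2. Taking \<open>m\<close> least bounds the growth
    \<open>3848 ^ m\<close> in terms of \<open>x\<close>.\<close>
  define small where "small m \<longleftrightarrow> x * (4 / 239) ^ m \<le> 120" for m
  have "\<exists>m. small m"
  proof -
    obtain m where "(4 / 239 :: real) ^ m < 120 / x"
      using real_arch_pow_inv[of "120 / x" "4 / 239"] x by auto
    then show ?thesis using x by (auto simp: small_def field_simps intro!: exI[of _ m])
  qed
  define m where "m = (LEAST m. small m)"
  have m: "small m" unfolding m_def using \<open>\<exists>m. small m\<close> by (rule LeastI_ex)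
  obtain n where n: "n = m \<or> n = Suc m" "\<bar>Im (cnj \<xi> * (3 + 2 * \<i>) * \<i> ^ n * pade n)\<bar> \<ge> 1"
    using W by (rule odd_linear_form)
  have "1 \<le> x * ((4 / 239) ^ n / 240) + y * (5 * 3848 ^ n)"
    using n(2) linear_form_le[OF sector(1), of n] unfolding x_def y_def by linarith
  moreover have "x * ((4 / 239) ^ n / 240) \<le> 1 / 2"
  proof -
    have "(4 / 239 :: real) ^ n \<le> (4 / 239) ^ m" using n(1) by (intro power_decreasing) auto
    then have "x * (4 / 239) ^ n \<le> x * (4 / 239) ^ m" using x by (intro mult_left_mono) auto
    also have "\<dots> \<le> 120" using m by (simp add: small_def)
    finally show ?thesis by simp
  qed
  moreover have "y * (5 * 3848 ^ n) \<le> y * (5 * 3848 ^ Suc m)"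
    using n(1) by (intro mult_left_mono mult_left_mono[of _ _ 5] power_increasing) (auto simp: y_def)
  ultimately have "1 / 2 \<le> y * (5 * 3848 ^ Suc m)" by linarith
  then have "x ^ 3 * (1 / 2) \<le> x ^ 3 * (y * (5 * 3848 ^ Suc m))"
    using x by (intro mult_left_mono) auto
  also have "\<dots> = (y * x ^ 3) * (5 * 3848 ^ Suc m)" by (simp only: mult_ac)
  also have "\<dots> \<le> 5 / 4 * (5 * 3848 ^ Suc m)" using y by (intro mult_right_mono) auto
  finally have x3: "x ^ 3 \<le> 25 / 2 * 3848 ^ Suc m" by simp
  have big: "x ^ 3 > 1400000 ^ 3" using x by (intro power_strict_mono) auto
  show False
  proof (cases m)
    case 0
    then show False using x3 big by simp
  next
    case (Suc k)
    then have "\<not> small k" unfolding m_def by (metis lessI not_less_Least)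
    then have "120 < x * (4 / 239) ^ k" by (simp add: small_def)
    then have "120 * (239 / 4) ^ k < (x * (4 / 239) ^ k) * (239 / 4) ^ k"
      by (intro mult_strict_right_mono) auto
    also have "\<dots> = x * ((4 / 239) * (239 / 4)) ^ k" by (simp only: power_mult_distrib mult.assoc)
    finally have k: "(239 / 4) ^ k \<le> x / 120" by simp
    have "x ^ 6 = (x ^ 3) ^ 2" by (simp flip: power_mult)
    also have "\<dots> \<le> (25 / 2 * 3848 ^ Suc m) ^ 2" using x3 x by (intro power_mono) auto
    also have "\<dots> = 625 / 4 * 3848 ^ 4 * (3848 ^ k) ^ 2"
      unfolding Suc power_Suc power_mult_distrib by (simp add: power_divide)
    also have "(3848 ^ k :: real) ^ 2 = (3848 ^ 2) ^ k" by (simp only: power_mult[symmetric] mult.commute)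
    \<comment> \<open>Here 3848^2 < (239/4)^5. The exponent 5, below the 6 on the left, leaves one
      power of \<open>x\<close> to be bounded.\<close>
    also have "625 / 4 * 3848 ^ 4 * (3848 ^ 2) ^ k \<le> (625 / 4 * 3848 ^ 4 * ((239 / 4) ^ 5) ^ k :: real)"
      by (intro mult_left_mono power_mono) (auto simp: power_divide)
    also have "((239 / 4 :: real) ^ 5) ^ k = ((239 / 4) ^ k) ^ 5" by (simp only: power_mult[symmetric] mult.commute)
    also have "625 / 4 * 3848 ^ 4 * ((239 / 4) ^ k) ^ 5 \<le> 625 / 4 * 3848 ^ 4 * (x / 120) ^ 5"
      using k by (intro mult_left_mono power_mono) auto
    also have "625 / 4 * 3848 ^ 4 * (x / 120) ^ 5 = x ^ 5 * (625 / 4 * 3848 ^ 4 / 120 ^ 5)"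
      by (simp add: power_divide)
    also have "x ^ 6 = x ^ 5 * x" by (simp flip: power_Suc2)
    finally have "x ^ 5 * x \<le> x ^ 5 * (625 / 4 * 3848 ^ 4 / 120 ^ 5)" .
    \<comment> \<open>The right side is about 1377000, which explains 1400000.\<close>
    then have "x \<le> 625 / 4 * 3848 ^ 4 / 120 ^ 5" using x by (simp only: mult_le_cancel_left_pos zero_less_power)
    then show False using x by simp
  qed
qed

text \<open>Rotating \<open>s\<close> by powers of \<open>\<i>\<close> preserves both its fourth
  power and the parity condition, so the sector may be assumed. The bound is twice the square of
  1400000, rounded up.\<close>

lemma gaussian_norm_le:
  fixes u v :: int
  defines "\<xi> \<equiv> of_int u + of_int v * \<i>"
  assumes "odd (u + v)" and s: "s = \<xi> \<or> s = (1 + \<i>) * \<xi>"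
    and p4: "Re ((rho * s) ^ 4) > 0" "\<bar>Im ((rho * s) ^ 4)\<bar> \<le> 4"
  shows "u ^ 2 + v ^ 2 \<le> 4000000000000"
proof -
  have W: "\<exists>a b. cnj (\<i> ^ j * s) * (3 + 2 * \<i>) = of_int a + of_int b * \<i> \<and> (odd a \<or> odd b)" for j
  proof (induction j)
    case 0
    from s show ?case
    proof
      assume "s = \<xi>"
      then have "cnj (\<i> ^ 0 * s) * (3 + 2 * \<i>) = of_int (3 * u + 2 * v) + of_int (2 * u - 3 * v) * \<i>"
        by (simp add: \<xi>_def complex_eq_iff)
      moreover have "odd (3 * u + 2 * v) \<or> odd (2 * u - 3 * v)" using assms(2) by auto
      ultimately show ?thesis by blast
    next
      assume "s = (1 + \<i>) * \<xi>"
      then have "cnj (\<i> ^ 0 * s) * (3 + 2 * \<i>) = of_int (5 * u - v) + of_int (- u - 5 * v) * \<i>"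
        by (simp add: \<xi>_def complex_eq_iff)
      moreover have "odd (5 * u - v) \<or> odd (- u - 5 * v)" using assms(2) by auto
      ultimately show ?thesis by blast
    qed
  next
    case (Suc j)
    then obtain a b where ab: "cnj (\<i> ^ j * s) * (3 + 2 * \<i>) = of_int a + of_int b * \<i>" "odd a \<or> odd b" by blast
    have "cnj (\<i> ^ Suc j * s) * (3 + 2 * \<i>) = - \<i> * (cnj (\<i> ^ j * s) * (3 + 2 * \<i>))" by simp
    also have "\<dots> = of_int b + of_int (- a) * \<i>" unfolding ab by (simp add: algebra_simps)
    finally show ?case using ab(2) by (intro exI[of _ b] exI[of _ "- a"]) auto
  qed
  have "rho * s \<noteq> 0" using p4(1) by auto
  then obtain j where j: "Re (\<i> ^ j * (rho * s)) > 0" "\<bar>Im (\<i> ^ j * (rho * s))\<bar> \<le> Re (\<i> ^ j * (rho * s))"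
    by (rule rotate_into_sector)
  have c: "\<i> ^ j * (rho * s) = rho * (\<i> ^ j * s)" by (simp only: mult_ac)
  have "(\<i> ^ j) ^ 4 = (1 :: complex)"
  proof -
    have "(\<i> ^ j) ^ 4 = (\<i> ^ 4) ^ j" by (simp flip: power_mult add: mult.commute)
    also have "\<i> ^ 4 = (1 :: complex)" by (simp add: power_numeral_reduce)
    finally show ?thesis by simp
  qed
  then have c4: "(rho * (\<i> ^ j * s)) ^ 4 = (rho * s) ^ 4" by (simp add: power_mult_distrib)
  obtain a b where ab: "cnj (\<i> ^ j * s) * (3 + 2 * \<i>) = of_int a + of_int b * \<i>" "odd a \<or> odd b" using W by blast
  have x: "Re (rho * (\<i> ^ j * s)) \<le> 1400000"
    using ab j p4 unfolding c by (intro sector_Re_le) (simp_all only: c4)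
  have "norm s = norm (\<i> ^ j * s)" by (simp add: norm_mult norm_power)
  also have "\<dots> \<le> norm rho * norm (\<i> ^ j * s)" using norm_rho_ge mult_right_mono[of 1 "norm rho"] by simp
  finally have "norm s ^ 2 \<le> norm (rho * (\<i> ^ j * s)) ^ 2" unfolding norm_mult[symmetric] by (intro power_mono) auto
  also have "\<dots> = Re (rho * (\<i> ^ j * s)) ^ 2 + \<bar>Im (rho * (\<i> ^ j * s))\<bar> ^ 2" by (simp add: cmod_power2)
  also have "\<dots> \<le> 1400000 ^ 2 + 1400000 ^ 2"
    using j x unfolding c by (intro add_mono power_mono) auto
  finally have n: "norm s ^ 2 \<le> 4000000000000" by simp
  have "norm \<xi> ^ 2 \<le> norm s ^ 2"
  proof -
    have "norm (1 + \<i>) ^ 2 = 2" by (simp add: cmod_power2)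
    then have "norm ((1 + \<i>) * \<xi>) ^ 2 = 2 * norm \<xi> ^ 2" by (simp only: norm_mult power_mult_distrib)
    then have "norm \<xi> ^ 2 \<le> norm ((1 + \<i>) * \<xi>) ^ 2" by (simp only:) simp
    then show ?thesis using s by (elim disjE) (simp_all only: order_refl)
  qed
  moreover have "norm \<xi> ^ 2 = of_int (u ^ 2 + v ^ 2)" by (simp add: \<xi>_def cmod_power2)
  ultimately have "real_of_int (u ^ 2 + v ^ 2) \<le> of_int 4000000000000" using n by simp
  then show ?thesis by (simp only: of_int_le_iff)
qed

text \<open>The form is \<open>A + B\<close> for \<open>\<xi> ^ 4 = A + B \<i>\<close>, so
  \<open>(rho * \<xi>) ^ 4\<close> has real part \<open>B - A\<close>, odd and hence nonzero. If it
  is negative, the extra factor \<open>1 + \<i>\<close>, with fourth power -4, makes it positive and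
  raises the imaginary part from size 1 to 4, the value allowed in the sector estimates.\<close>

lemma thue_bound:
  fixes u v :: int
  assumes "\<bar>u ^ 4 + 4 * u ^ 3 * v - 6 * u ^ 2 * v ^ 2 - 4 * u * v ^ 3 + v ^ 4\<bar> = 1"
  shows "u ^ 2 + v ^ 2 \<le> 4000000000000"
proof -
  define A B where "A = u ^ 4 - 6 * u ^ 2 * v ^ 2 + v ^ 4" and "B = 4 * u ^ 3 * v - 4 * u * v ^ 3"
  define \<xi> where "\<xi> = (of_int u + of_int v * \<i> :: complex)"
  have AB: "\<bar>A + B\<bar> = 1" using assms by (simp add: A_def B_def algebra_simps)
  then have "odd (A + B)" by presburger
  then have odd_uv: "odd (u + v)" by (simp add: A_def B_def)
  have "odd (B - A)" using \<open>odd (A + B)\<close> by simp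
  then have "B - A \<noteq> 0" by (metis even_zero)
  have "\<xi> ^ 4 = of_int A + of_int B * \<i>"
    unfolding \<xi>_def A_def B_def by (simp add: power_numeral_reduce algebra_simps)
  then have r1: "(rho * \<xi>) ^ 4 = of_int (B - A) - of_int (A + B) * \<i>"
    unfolding power_mult_distrib rho_power4 by (simp add: algebra_simps)
  have "(1 + \<i>) ^ 4 = -4" by (simp add: power_numeral_reduce algebra_simps)
  then have r2: "(rho * ((1 + \<i>) * \<xi>)) ^ 4 = -4 * (of_int (B - A) - of_int (A + B) * \<i>)"
    unfolding r1[symmetric] by (simp add: power_mult_distrib)
  have AB': "\<bar>real_of_int (A + B)\<bar> = 1" using AB by linarith
  show ?thesis
  proof (cases "B - A > 0")
    case True
    then have "0 < real_of_int (B - A)" by (simp only: of_int_0_less_iff)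
    then show ?thesis
      using AB' by (intro gaussian_norm_le[OF odd_uv, of \<xi>]) (simp_all add: \<xi>_def[symmetric] r1 del: of_int_add of_int_diff)
  next
    case False
    then have "real_of_int (B - A) < 0" using \<open>B - A \<noteq> 0\<close> by linarith
    then show ?thesis
      using AB' by (intro gaussian_norm_le[OF odd_uv, of "(1 + \<i>) * \<xi>"])
        (simp_all add: \<xi>_def[symmetric] r2 abs_mult del: of_int_add of_int_diff)
  qed
qed

section \<open>The Pell sequence and the finite check\<close>

fun pell_step :: "nat \<times> nat \<Rightarrow> nat \<times> nat" where
  "pell_step (f, c) = (3 * f + 4 * c, 2 * f + 3 * c)"

primrec orbit :: "('a \<Rightarrow> 'a) \<Rightarrow> nat \<Rightarrow> 'a \<Rightarrow> 'a list" where
  "orbit h 0 x = []"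
| "orbit h (Suc n) x = x # orbit h n (h x)"

lemma funpow_in_orbit: "k < n \<Longrightarrow> (h ^^ k) x \<in> set (orbit h n x)"
proof (induction n arbitrary: k x)
  case (Suc n)
  then show ?case by (cases k) (auto simp: funpow_swap1 intro: Suc.IH)
qed simp

text \<open>\<open>pell_step\<close> multiplies \<open>f + c sqrt 2\<close> by
  \<open>3 + 2 sqrt 2\<close>; the descent multiplies by the inverse \<open>3 - 2 sqrt 2\<close>
  until it reaches \<open>(1, 1)\<close>. As \<open>c' \<le> f'\<close>, each step multiplies
  \<open>c\<close> by at least 5.\<close>

lemma negative_pell_solution:
  fixes f c :: nat
  assumes "f ^ 2 + 1 = 2 * c ^ 2"
  shows "\<exists>k. (f, c) = (pell_step ^^ k) (1, 1) \<and> 5 ^ k \<le> c"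
  using assms
proof (induction c arbitrary: f rule: less_induct)
  case (less c)
  have "c \<noteq> 0" using less.prems by (intro notI) simp
  show ?case
  proof (cases "c = 1")
    case True
    then have "f ^ 2 = 1 ^ 2" using less.prems by simp
    then have "f = 1" by (simp only: power2_eq_iff_nonneg)
    then show ?thesis using True by (intro exI[of _ 0]) simp
  next
    case False
    then have c2: "c \<ge> 2" using \<open>c \<noteq> 0\<close> by simp
    have "c \<noteq> 2"
    proof
      assume "c = 2"
      then have "2 ^ 2 < f ^ 2" "f ^ 2 < 3 ^ 2" using less.prems by simp_all
      then have "2 < f" "f < 3" by (simp_all only: power_less_imp_less_base)
      then show False by simp
    qed
    then have c: "c \<ge> 3" using c2 by simp
    then have "c * c \<ge> 3 * 3" by (intro mult_le_mono) auto
    then have "c ^ 2 < f ^ 2" using less.prems by (simp add: power2_eq_square)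
    then have fc: "c < f" by (simp only: power_less_imp_less_base)
    have "(3 * f) ^ 2 \<ge> (4 * c) ^ 2"
      using less.prems \<open>c * c \<ge> 3 * 3\<close> by (simp add: power2_eq_square)
    then have a: "4 * c \<le> 3 * f" by (simp only: power2_nat_le_eq_le)
    have "(2 * f) ^ 2 < (3 * c) ^ 2"
      using less.prems \<open>c * c \<ge> 3 * 3\<close> by (simp add: power2_eq_square)
    then have b: "2 * f < 3 * c" by (simp only: power_less_imp_less_base)
    define f' c' where fc': "f' = 3 * f - 4 * c" "c' = 3 * c - 2 * f"
    have prev: "f = 3 * f' + 4 * c'" "c = 2 * f' + 3 * c'" using a b fc' by simp_all
    have "int f' ^ 2 + 1 = 2 * int c' ^ 2"
    proof -
      have "int f ^ 2 + 1 = 2 * int c ^ 2" using less.prems by (metis of_nat_1 of_nat_add of_nat_mult of_nat_numeral of_nat_power)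
      then show ?thesis unfolding prev by (simp add: power2_eq_square algebra_simps)
    qed
    then have "int (f' ^ 2 + 1) = int (2 * c' ^ 2)" by simp
    then have e: "f' ^ 2 + 1 = 2 * c' ^ 2" by (simp only: of_nat_eq_iff)
    have "c' < c" using fc b c fc' by linarith
    then obtain k where k: "(f', c') = (pell_step ^^ k) (1, 1)" "5 ^ k \<le> c'" using less.IH e by blast
    have "c' \<le> f'"
    proof (rule ccontr)
      assume "\<not> c' \<le> f'"
      then have "(f' + 1) ^ 2 \<le> c' ^ 2" by (intro power_mono) auto
      then show False using e by (simp add: power2_eq_square)
    qed
    then have "5 ^ Suc k \<le> c" using k(2) unfolding prev(2) by simp
    moreover have "(f, c) = (pell_step ^^ Suc k) (1, 1)"
    proof -
      have "(f, c) = pell_step (f', c')" using prev by simp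
      also have "\<dots> = (pell_step ^^ Suc k) (1, 1)" unfolding k(1) by simp
      finally show ?thesis .
    qed
    ultimately show ?thesis by blast
  qed
qed

lemma orbit_numeral [simp]: "orbit h (numeral n) x = x # orbit h (pred_numeral n) (h x)"
  by (simp add: numeral_eq_Suc)

lemma orbit_1 [simp]: "orbit h 1 x = [x]"
  by simp

lemma list_all2_in_setE:
  assumes "list_all2 P xs ys" "x \<in> set xs"
  obtains y where "P x y"
  using assms by (induction rule: list_all2_induct) auto

text \<open>The listed numbers are the integer parts of the square roots of the second components.
  They certify that none of these is a square except 1 and 169, which belong to \<open>y = 1\<close>
  and \<open>y = 13\<close>.\<close>

lemma pell_orbit_squares:
  "list_all2 (\<lambda>(f, c) r. c = 1 \<or> c = 169 \<or> r ^ 2 < c \<and> c < (r + 1) ^ 2) (orbit pell_step 37 (1, 1))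
     [1, 2, 5, 13, 31, 75, 182, 441, 1066, 2573, 6214, 15001, 36217, 87437, 211093, 509624,
      1230343, 2970311, 7170966, 17312244, 41795454, 100903153, 243601760, 588106675,
      1419815110, 3427736897, 8275288905, 19978314707, 48231918319, 116442151345, 281116221011,
      678674593367, 1638465407746, 3955605408861, 9549676225469, 23054957859800, 55659591945070]"
  by (simp del: One_nat_def)

lemma ljunggren_bounded:
  fixes x y :: nat
  assumes "x ^ 2 + 1 = 2 * y ^ 4" "y \<le> 4000000000000"
  shows "y = 1 \<or> y = 13"
proof -
  have "x ^ 2 + 1 = 2 * (y ^ 2) ^ 2" using assms(1) by (simp flip: power_mult)
  then obtain k where k: "(x, y ^ 2) = (pell_step ^^ k) (1, 1)" "5 ^ k \<le> y ^ 2"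
    using negative_pell_solution by blast
  have "y ^ 2 \<le> 4000000000000 ^ 2" using assms(2) by (intro power_mono) auto
  \<comment> \<open>37 is the least exponent for which this holds, hence the length of the
    table.\<close>
  also have "\<dots> < (5 :: nat) ^ 37" by simp
  finally have "(5 :: nat) ^ k < 5 ^ 37" using k(2) by linarith
  then have "k < 37" by (rule power_less_imp_less_exp[rotated]) simp
  then have "(x, y ^ 2) \<in> set (orbit pell_step 37 (1, 1))" unfolding k(1) by (rule funpow_in_orbit)
  with pell_orbit_squares obtain r
    where "(case (x, y ^ 2) of (f, c) \<Rightarrow> \<lambda>r. c = 1 \<or> c = 169 \<or> r ^ 2 < c \<and> c < (r + 1) ^ 2) r"
    by (rule list_all2_in_setE)
  then have "y ^ 2 = 1 \<or> y ^ 2 = 169 \<or> r ^ 2 < y ^ 2 \<and> y ^ 2 < (r + 1) ^ 2" by (simp only: prod.case)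
  moreover have "\<not> (r ^ 2 < y ^ 2 \<and> y ^ 2 < (r + 1) ^ 2)"
  proof
    assume "r ^ 2 < y ^ 2 \<and> y ^ 2 < (r + 1) ^ 2"
    then have "r < y" "y < r + 1" by (auto dest: power_less_imp_less_base)
    then show False by simp
  qed
  moreover have "y = 13" if "y ^ 2 = 169"
  proof -
    have "y ^ 2 = 13 ^ 2" using that by simp
    then show ?thesis by (simp only: power2_eq_iff_nonneg)
  qed
  moreover have "y = 1" if "y ^ 2 = 1" using that by simp
  ultimately show ?thesis by blast
qed

text \<open>For \<open>x = 2 k + 1\<close> the numbers \<open>k\<close>, \<open>k + 1\<close>,
  \<open>y^2\<close> form a Pythagorean triple. Parametrizing it, and then
  \<open>y^2 = m^2 + n^2\<close> once more, turns the difference 1 of the legs into the sum of the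
  real and imaginary parts of a fourth power \<open>(u + v \<i>)^4\<close>, up to sign.\<close>

lemma ljunggren_parametrization:
  fixes x y :: nat
  assumes "x ^ 2 + 1 = 2 * y ^ 4"
  obtains u v :: int
  where "\<bar>u ^ 4 + 4 * u ^ 3 * v - 6 * u ^ 2 * v ^ 2 - 4 * u * v ^ 3 + v ^ 4\<bar> = 1" "int y = u ^ 2 + v ^ 2"
proof -
  have "odd (x ^ 2 + 1) = False" using assms by simp
  then have "odd x" by simp
  then obtain k where k: "x = 2 * k + 1" by (rule oddE)
  have kk: "k ^ 2 + (k + 1) ^ 2 = (y ^ 2) ^ 2"
    using assms unfolding k by (simp add: power2_eq_square power_numeral_reduce)
  obtain e o' where eo: "e ^ 2 + o' ^ 2 = (y ^ 2) ^ 2" "coprime e o'" "even e" "\<bar>int o' - int e\<bar> = 1"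
  proof (cases "even k")
    case True
    then show thesis using that[of k "k + 1"] kk by simp
  next
    case False
    then show thesis using that[of "k + 1" k] kk by (simp add: add.commute coprime_commute)
  qed
  from eo(1-3) obtain m n where mn: "e = 2 * m * n" "o' + n ^ 2 = m ^ 2" "y ^ 2 = m ^ 2 + n ^ 2" "coprime m n"
    by (rule pythagorean_tripleE)
  have leg: "\<bar>int m ^ 2 - int n ^ 2 - 2 * int m * int n\<bar> = 1"
  proof -
    have "int o' = int m ^ 2 - int n ^ 2" using arg_cong[OF mn(2), of int] by simp
    then show ?thesis using eo(4) mn(1) by simp
  qed
  have "odd (int m ^ 2 - int n ^ 2 - 2 * int m * int n)" using leg by presburger
  then have "even m \<or> even n" by auto
  then show thesis
  proof
    assume "even n"
    have "n ^ 2 + m ^ 2 = y ^ 2" "coprime n m" using mn by (simp_all add: coprime_commute)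
    then obtain r s where rs: "n = 2 * r * s" "m + s ^ 2 = r ^ 2" "y = r ^ 2 + s ^ 2" "coprime r s"
      using \<open>even n\<close> by (rule pythagorean_tripleE)
    have m: "int m = int r ^ 2 - int s ^ 2" using arg_cong[OF rs(2), of int] by simp
    show thesis
    proof (rule that[of "int r" "- int s"])
      show "\<bar>int r ^ 4 + 4 * int r ^ 3 * (- int s) - 6 * int r ^ 2 * (- int s) ^ 2 - 4 * int r * (- int s) ^ 3 + (- int s) ^ 4\<bar> = 1"
        using leg unfolding m rs(1) by (simp add: power_numeral_reduce algebra_simps)
      show "int y = int r ^ 2 + (- int s) ^ 2" using rs(3) by simp
    qed
  next
    assume "even m"
    have "m ^ 2 + n ^ 2 = y ^ 2" using mn by simp
    then obtain r s where rs: "m = 2 * r * s" "n + s ^ 2 = r ^ 2" "y = r ^ 2 + s ^ 2" "coprime r s"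
      using mn(4) \<open>even m\<close> by (rule pythagorean_tripleE)
    have n: "int n = int r ^ 2 - int s ^ 2" using arg_cong[OF rs(2), of int] by simp
    show thesis
    proof (rule that[of "int r" "int s"])
      have "int r ^ 4 + 4 * int r ^ 3 * int s - 6 * int r ^ 2 * int s ^ 2 - 4 * int r * int s ^ 3 + int s ^ 4
          = - (int m ^ 2 - int n ^ 2 - 2 * int m * int n)"
        unfolding n rs(1) by (simp add: power_numeral_reduce algebra_simps)
      then show "\<bar>int r ^ 4 + 4 * int r ^ 3 * int s - 6 * int r ^ 2 * int s ^ 2 - 4 * int r * int s ^ 3 + int s ^ 4\<bar> = 1"
        using leg by simp
      show "int y = int r ^ 2 + int s ^ 2" using rs(3) by simp
    qed
  qed
qed

theorem ljunggren:
  fixes x y :: nat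
  assumes "x ^ 2 + 1 = 2 * y ^ 4"
  shows "y = 1 \<or> y = 13"
proof (rule ljunggren_bounded[OF assms])
  obtain u v :: int
    where uv: "\<bar>u ^ 4 + 4 * u ^ 3 * v - 6 * u ^ 2 * v ^ 2 - 4 * u * v ^ 3 + v ^ 4\<bar> = 1" "int y = u ^ 2 + v ^ 2"
    using assms by (rule ljunggren_parametrization)
  then show "y \<le> 4000000000000" using thue_bound[OF uv(1)] by simp
qed

section \<open>Points on the curve over the cubic field\<close>

lemma congruent_three_rational_points_real:
  fixes x y :: real
  assumes "x \<in> \<rat>" "y \<in> \<rat>" "y ^ 2 = x ^ 3 - 9 * x"
  shows "x = 0 \<or> x = 3 \<or> x = -3"
proof -
  obtain x' y' where xy: "x = of_rat x'" "y = of_rat y'" using assms(1,2) by (auto elim!: Rats_cases)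
  have "of_rat (y' ^ 2) = (of_rat (x' ^ 3 - 9 * x') :: real)"
    using assms(3) unfolding xy by (simp add: of_rat_diff of_rat_mult of_rat_power)
  then have "y' ^ 2 = x' ^ 3 - 9 * x'" by (simp only: of_rat_eq_iff)
  then have "y' = 0" by (rule congruent_three_rational_points)
  then have "x ^ 3 - 9 * x = 0" using assms(3) xy by simp
  moreover have "x ^ 3 - 9 * x = x * ((x - 3) * (x + 3))"
    by (simp add: algebra_simps power_numeral_reduce)
  ultimately show ?thesis by auto
qed

text \<open>The remainder of the squared equation modulo the cubic vanishes by linear independence
  of 1, \<open>\<phi>\<close>, \<open>\<phi> ^ 2\<close>; its three coefficients give the equations,
  and \<open>l\<close> is the constant term of the quotient.\<close>

lemma K_point_coefficients:
  fixes d y :: real and t :: int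
  defines "\<phi> \<equiv> theta t - 1" and "T \<equiv> real_of_int t"
  assumes "t \<ge> -1" "d \<in> \<rat>" "d > 0" "y \<in> K t" "y ^ 2 = (\<phi> / d ^ 2) ^ 3 - 9 * (\<phi> / d ^ 2)"
  obtains a b c l where "a \<in> \<rat>" "b \<in> \<rat>" "c \<in> \<rat>" "l = 2 * b * c - 1 - (3 - T) * c ^ 2"
    "b ^ 2 + 2 * a * c = - 3 * T * c ^ 2 + (3 - T) * l"
    "2 * a * b + 9 * d ^ 4 = - (2 * T + 3) * c ^ 2 - 3 * T * l"
    "a ^ 2 = - (2 * T + 3) * l"
proof -
  interpret irreducible_cubic \<phi> "3 - T" "- 3 * T" "- (2 * T + 3)"
    unfolding \<phi>_def T_def using assms(3) by (rule irreducible_cubic_theta)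
  have "d ^ 3 * y \<in> span3"
    using K_subset_span3[OF assms(3)] assms Rats_subset_span3 by (intro span3_mult) (auto simp: \<phi>_def)
  then obtain a b c where abc: "a \<in> \<rat>" "b \<in> \<rat>" "c \<in> \<rat>" "d ^ 3 * y = a + b * \<phi> + c * \<phi> ^ 2"
    by (rule span3E)
  define l where "l = 2 * b * c - 1 - (3 - T) * c ^ 2"
  have "(a + b * \<phi> + c * \<phi> ^ 2) ^ 2 = \<phi> ^ 3 - 9 * d ^ 4 * \<phi>"
    unfolding abc(4)[symmetric] power_mult_distrib assms(7)
    using \<open>d > 0\<close> by (simp add: field_simps power_numeral_reduce)
  moreover have "(a + b * \<phi> + c * \<phi> ^ 2) ^ 2 - (\<phi> ^ 3 - 9 * d ^ 4 * \<phi>) =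
      (a ^ 2 + (2 * T + 3) * l) + (2 * a * b + 9 * d ^ 4 + (2 * T + 3) * c ^ 2 + 3 * T * l) * \<phi>
      + (b ^ 2 + 2 * a * c + 3 * T * c ^ 2 - (3 - T) * l) * \<phi> ^ 2
      + (\<phi> ^ 3 + (3 - T) * \<phi> ^ 2 + (- 3 * T) * \<phi> + - (2 * T + 3)) * (c ^ 2 * \<phi> + l)"
    unfolding l_def by (simp add: algebra_simps power_numeral_reduce)
  ultimately have z: "(a ^ 2 + (2 * T + 3) * l) + (2 * a * b + 9 * d ^ 4 + (2 * T + 3) * c ^ 2 + 3 * T * l) * \<phi>
      + (b ^ 2 + 2 * a * c + 3 * T * c ^ 2 - (3 - T) * l) * \<phi> ^ 2 = 0"
    using root by simp
  have T: "T \<in> \<rat>" by (simp add: T_def)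
  have R: "a ^ 2 + (2 * T + 3) * l \<in> \<rat>" "2 * a * b + 9 * d ^ 4 + (2 * T + 3) * c ^ 2 + 3 * T * l \<in> \<rat>"
    "b ^ 2 + 2 * a * c + 3 * T * c ^ 2 - (3 - T) * l \<in> \<rat>"
    unfolding l_def using abc(1-3) T assms(4) by simp_all
  note e = linear_independent3[OF R z]
  show thesis
    by (rule that[OF abc(1-3) l_def]) (use e in linarith)+
qed

text \<open>The cubic divides \<open>(a + b X + c X\<^sup>2)\<^sup>2 - (X\<^sup>3 - 9 d\<^sup>4 X)\<close> with quotient \<open>c\<^sup>2 X + l\<close>; for nonzero \<open>c\<close>, the root
  of this quotient yields a rational point of \<open>y\<^sup>2 = x\<^sup>3 - 9 x\<close>.\<close>

lemma K_point_leading_coefficient_eq_0: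
  fixes a b c d l :: real and t :: int
  defines "T \<equiv> real_of_int t"
  assumes "t \<ge> -1" "d \<in> \<rat>" "d > 0" "a \<in> \<rat>" "b \<in> \<rat>" "c \<in> \<rat>"
    and l: "l = 2 * b * c - 1 - (3 - T) * c ^ 2"
    and e2: "b ^ 2 + 2 * a * c = - 3 * T * c ^ 2 + (3 - T) * l"
    and e1: "2 * a * b + 9 * d ^ 4 = - (2 * T + 3) * c ^ 2 - 3 * T * l"
    and e0: "a ^ 2 = - (2 * T + 3) * l"
  shows "c = 0"
proof (rule ccontr)
  assume c: "c \<noteq> 0"
  have T: "2 * T + 3 > 0" "T \<in> \<rat>" using \<open>t \<ge> -1\<close> by (auto simp: T_def)
  define q where "q = - l / c ^ 2"
  have lq: "l = - (c ^ 2 * q)" using c by (simp add: q_def)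
  have id: "(a + b * x + c * x ^ 2) ^ 2 - (x ^ 3 - 9 * d ^ 4 * x) =
      (x ^ 3 + (3 - T) * x ^ 2 + (- 3 * T) * x + - (2 * T + 3)) * (c ^ 2 * x + l)" for x
  proof -
    have "(a + b * x + c * x ^ 2) ^ 2 - (x ^ 3 - 9 * d ^ 4 * x) =
        a ^ 2 + (2 * a * b + 9 * d ^ 4) * x + (b ^ 2 + 2 * a * c) * x ^ 2
        + ((2 * b * c - 1 - (3 - T) * c ^ 2) + (3 - T) * c ^ 2) * x ^ 3 + c ^ 2 * x ^ 4"
      by (simp add: algebra_simps power_numeral_reduce)
    also have "\<dots> = - (2 * T + 3) * l + (- (2 * T + 3) * c ^ 2 - 3 * T * l) * x
        + (- 3 * T * c ^ 2 + (3 - T) * l) * x ^ 2 + (l + (3 - T) * c ^ 2) * x ^ 3 + c ^ 2 * x ^ 4"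
      by (simp only: e0 e1 e2 l[symmetric])
    also have "\<dots> = (x ^ 3 + (3 - T) * x ^ 2 + (- 3 * T) * x + - (2 * T + 3)) * (c ^ 2 * x + l)"
      by (simp add: algebra_simps power_numeral_reduce)
    finally show ?thesis .
  qed
  have qR: "q \<in> \<rat>" unfolding q_def l using assms(5-7) T by simp
  have qp: "(a + b * q + c * q ^ 2) ^ 2 = q ^ 3 - 9 * d ^ 4 * q" using id[of q] lq by simp
  define x y where xy: "x = q / d ^ 2" "y = (a + b * q + c * q ^ 2) / d ^ 3"
  have "y ^ 2 = x ^ 3 - 9 * x"
    unfolding xy power_divide qp using \<open>d > 0\<close> by (simp add: field_simps power_numeral_reduce)
  moreover have "x \<in> \<rat>" "y \<in> \<rat>" unfolding xy using qR assms(3-7) by simp_all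
  ultimately have "x = 0 \<or> x = 3 \<or> x = -3" by (intro congruent_three_rational_points_real[of x y])
  then have q: "q = 0 \<or> q = 3 * d ^ 2 \<or> q = - (3 * d ^ 2)"
    unfolding xy using \<open>d > 0\<close> by (auto simp: field_simps)
  have a2: "a ^ 2 = c ^ 2 * (2 * T + 3) * q" unfolding e0 lq by (simp add: algebra_simps)
  have "c ^ 2 * (2 * T + 3) > 0" using c T by simp
  \<comment> \<open>Positivity of the norm \<open>2 T + 3\<close> rules out the torsion point with
    abscissa -3.\<close>
  then have "q \<ge> 0" using a2 by (metis zero_le_power2 zero_le_mult_iff not_less)
  then consider "q = 0" | "q = 3 * d ^ 2"
    using q \<open>d > 0\<close> by (metis neg_0_le_iff_le not_less zero_less_mult_iff zero_less_numeral zero_less_power)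
  then show False
  proof cases
    case 1
    then have "9 * d ^ 4 = - (2 * T + 3) * c ^ 2" using a2 lq e1 by simp
    moreover have "(2 * T + 3) * c ^ 2 > 0" using T c by simp
    moreover have "9 * d ^ 4 > 0" using \<open>d > 0\<close> by simp
    ultimately show False by linarith
  next
    case 2
    define A B where AB: "A = a / c" "B = b / c"
    have ab: "a = c * A" "b = c * B" using c AB by simp_all
    have "q ^ 3 - 9 * d ^ 4 * q = 0" unfolding 2 by (simp add: power_numeral_reduce)
    then have "a + b * q + c * q ^ 2 = 0" using qp by simp
    moreover have "a + b * q + c * q ^ 2 = c * (A + 3 * d ^ 2 * B + 9 * d ^ 4)"
      unfolding ab 2 by (simp add: algebra_simps power_numeral_reduce)
    ultimately have "c * (A + 3 * d ^ 2 * B + 9 * d ^ 4) = 0" by simp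
    then have 1: "A + 3 * d ^ 2 * B + 9 * d ^ 4 = 0" using c by simp
    have "c ^ 2 * A ^ 2 = c ^ 2 * (3 * d ^ 2 * (2 * T + 3))"
      using a2 unfolding ab 2 by (simp add: algebra_simps)
    then have 3: "A ^ 2 = 3 * d ^ 2 * (2 * T + 3)" using c by simp
    have "c ^ 2 * (B ^ 2 + 2 * A) = b ^ 2 + 2 * a * c" unfolding ab by (simp add: algebra_simps power2_eq_square)
    also have "\<dots> = c ^ 2 * (- 3 * T - 3 * d ^ 2 * (3 - T))"
      unfolding e2 lq 2 by (simp add: algebra_simps)
    finally have "c ^ 2 * (B ^ 2 + 2 * A) = c ^ 2 * (- 3 * T - 3 * d ^ 2 * (3 - T))" .
    then have 4: "B ^ 2 + 2 * A = - 3 * T - 3 * d ^ 2 * (3 - T)" using c by simp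
    have "A \<in> \<rat>" unfolding AB using assms by simp
    then show False using no_solution_three_adic[OF \<open>d \<in> \<rat>\<close> _ \<open>d > 0\<close>] 1 3 4 unfolding T_def by blast
  qed
qed

text \<open>Rationals with integral square are integers; this applies to \<open>3 d^2\<close> and
  then to \<open>3 d\<close>. The last factor 3 goes because the fourth power of \<open>3 d\<close>
  is a multiple of 9.\<close>

lemma rat_fourth_power_int:
  fixes d :: real
  assumes "d \<in> \<rat>" "9 * d ^ 4 = of_int z"
  obtains k where "d = of_int k"
proof -
  have "(3 * d ^ 2) ^ 2 = of_int z" using assms(2) by (simp add: power_mult_distrib)
  then obtain m where m: "3 * d ^ 2 = of_int m" using assms(1) by (metis rat_square_int Rats_mult Rats_power Rats_number_of)
  then have "(3 * d) ^ 2 = of_int (3 * m)" by (simp add: power_mult_distrib)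
  then obtain j where j: "3 * d = of_int j" using assms(1) by (metis rat_square_int Rats_mult Rats_number_of)
  have "real_of_int (j ^ 4) = of_int (9 * z)"
    unfolding of_int_power j[symmetric] using assms(2) by (simp add: power_mult_distrib)
  then have "j ^ 4 = 9 * z" by (simp only: of_int_eq_iff)
  then have "3 dvd j ^ 4" by simp
  then have "3 dvd j" by (rule prime_dvd_power[rotated]) simp
  then obtain k where "j = 3 * k" by auto
  then show thesis using that j by simp
qed

text \<open>Here \<open>a\<close>, \<open>b\<close> are the coefficients of the line through the
  conjugate points, with \<open>t = b^2 + 3\<close>. Both are multiples of 3, and
  \<open>u + v sqrt 2\<close> has norm 1; multiplied by \<open>sqrt 2 - 1\<close> it becomes
  \<open>f + c sqrt 2\<close> of norm -1, while the second equation reads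
  \<open>c^2 = d^4\<close>.\<close>

lemma simultaneous_pell:
  fixes a b d :: int
  assumes "a ^ 2 = 2 * b ^ 2 + 9" "9 * d ^ 4 = 3 * b ^ 2 - 2 * a * b + 9" "d > 0"
  shows "(d, b ^ 2 + 3) \<in> {(1, 3), (1, 39), (13, 44103), (13, 1498179)}"
proof -
  have "3 dvd 3 * (3 * d ^ 4 - b ^ 2 + 3)" by simp
  also have "3 * (3 * d ^ 4 - b ^ 2 + 3) = 18 - 2 * (a * b)" using assms(2) by (simp add: algebra_simps)
  finally have "3 dvd a * b" by presburger
  moreover have p3: "prime (3 :: int)" by simp
  ultimately have "3 dvd a \<or> 3 dvd b" using prime_dvd_mult_iff by blast
  moreover have "3 dvd b" if "3 dvd a"
  proof -
    have "3 dvd a ^ 2 - 9" using that by (auto simp: power2_eq_square)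
    then have "3 dvd 2 * b ^ 2" using assms(1) by simp
    then have "3 dvd b ^ 2" by presburger
    then show ?thesis by (rule prime_dvd_power[OF p3])
  qed
  moreover have "3 dvd a" if "3 dvd b"
  proof -
    have "3 dvd a ^ 2" using assms(1) that by (auto simp: power2_eq_square)
    then show ?thesis by (rule prime_dvd_power[OF p3])
  qed
  ultimately obtain u v where uv: "a = 3 * u" "b = 3 * v" by (meson dvdE)
  have u: "u ^ 2 = 2 * v ^ 2 + 1" using assms(1) unfolding uv by (simp add: power_mult_distrib)
  define c f where cf: "c = u - v" "f = 2 * v - u"
  have "9 * d ^ 4 = 9 * (3 * v ^ 2 - 2 * u * v + 1)"
    using assms(2) unfolding uv by (simp add: power_mult_distrib)
  then have "d ^ 4 = u ^ 2 - 2 * u * v + v ^ 2" using u by simp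
  also have "\<dots> = c ^ 2" unfolding cf by (simp add: power2_eq_square algebra_simps)
  finally have d4: "d ^ 4 = c ^ 2" .
  then have cd: "(d ^ 2) ^ 2 = c ^ 2" by (simp flip: power_mult)
  have "f ^ 2 + 1 = 2 * c ^ 2" using u unfolding cf by (simp add: power2_eq_square algebra_simps)
  then have fd: "f ^ 2 + 1 = 2 * d ^ 4" using d4 by simp
  then have "int (nat \<bar>f\<bar> ^ 2 + 1) = int (2 * nat d ^ 4)" using assms(3) by simp
  then have "nat d = 1 \<or> nat d = 13" using ljunggren by (metis of_nat_eq_iff)
  then have d: "d = 1 \<or> d = 13" using assms(3) by auto
  have c: "c = d ^ 2 \<or> c = - (d ^ 2)" using cd by (metis power2_eq_iff)
  have f: "f = 1 \<or> f = -1" if "d = 1"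
    using fd that by (auto simp: power2_eq_1_iff)
  have f': "f = 239 \<or> f = -239" if "d = 13"
  proof -
    have "f ^ 2 = 239 ^ 2" using fd that by simp
    then show ?thesis by (simp only: power2_eq_iff)
  qed
  \<comment> \<open>The signs of \<open>f\<close> and \<open>c\<close> are independent:
    \<open>v\<close> is 0 or 2 for \<open>d = 1\<close>, and 70 or 408 for \<open>d = 13\<close>, up
    to sign. This gives two values of \<open>t\<close> for each \<open>d\<close>.\<close>
  have "v = f + c" unfolding cf by simp
  then show ?thesis using d c f f' unfolding uv by (elim disjE) (auto split: if_splits)
qed

theorem theorem2:
  fixes d :: rat and t :: int
  assumes "d > 0" and "t \<ge> -1"
  shows "(\<exists>P \<in> E3 (K t). P \<noteq> Infinity \<and> abscissa P = (theta t - 1) / (of_rat d) ^ 2) \<longleftrightarrow>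
    (d, t) \<in> {(1, 3), (1, 39), (13, 44103), (13, 1498179)}"
proof
  define D where "D = (of_rat d :: real)"
  have D: "D \<in> \<rat>" "D > 0" using assms by (auto simp: D_def)
  define T where "T = real_of_int t"
  assume "\<exists>P \<in> E3 (K t). P \<noteq> Infinity \<and> abscissa P = (theta t - 1) / (of_rat d) ^ 2"
  then obtain y where "y \<in> K t" "y ^ 2 = ((theta t - 1) / D ^ 2) ^ 3 - 9 * ((theta t - 1) / D ^ 2)"
    by (auto simp: E3_def weierstrass_points_def D_def)
  with K_point_coefficients[OF assms(2) D] obtain a b c l where
    *: "a \<in> \<rat>" "b \<in> \<rat>" "c \<in> \<rat>" "l = 2 * b * c - 1 - (3 - T) * c ^ 2"
    "b ^ 2 + 2 * a * c = - 3 * T * c ^ 2 + (3 - T) * l"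
    "2 * a * b + 9 * D ^ 4 = - (2 * T + 3) * c ^ 2 - 3 * T * l"
    "a ^ 2 = - (2 * T + 3) * l"
    unfolding T_def by metis
  have c: "c = 0"
    using K_point_leading_coefficient_eq_0[OF assms(2) D *(1-3)] *(4-7) unfolding T_def by blast
  then have e: "b ^ 2 = T - 3" "2 * a * b + 9 * D ^ 4 = 3 * T" "a ^ 2 = 2 * T + 3" using * by simp_all
  obtain b' where b': "b = of_int b'" using rat_square_int[of b "t - 3"] e(1) *(2) by (auto simp: T_def)
  obtain a' where a': "a = of_int a'" using rat_square_int[of a "2 * t + 3"] e(3) *(1) by (auto simp: T_def)
  have "9 * D ^ 4 = of_int (3 * t - 2 * a' * b')" using e(2) a' b' by (simp add: T_def)
  then obtain d' where d': "D = of_int d'" using rat_fourth_power_int D(1) by blast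
  have "real_of_int (b' ^ 2) = of_int (t - 3)" "real_of_int (a' ^ 2) = of_int (2 * t + 3)"
    "real_of_int (2 * a' * b' + 9 * d' ^ 4) = of_int (3 * t)"
    using e unfolding a' b' d' T_def by simp_all
  then have i: "b' ^ 2 = t - 3" "a' ^ 2 = 2 * t + 3" "2 * a' * b' + 9 * d' ^ 4 = 3 * t"
    by (simp_all only: of_int_eq_iff)
  have "(d', b' ^ 2 + 3) \<in> {(1, 3), (1, 39), (13, 44103), (13, 1498179)}"
    by (rule simultaneous_pell[of a']) (use i D(2) d' in auto)
  moreover have "d = of_int d'" using d' unfolding D_def by (metis of_rat_eq_iff of_rat_of_int_eq)
  ultimately show "(d, t) \<in> {(1, 3), (1, 39), (13, 44103), (13, 1498179)}" using i(1) by auto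
next
  assume dt: "(d, t) \<in> {(1, 3), (1, 39), (13, 44103), (13, 1498179)}"
  define D where "D = (of_rat d :: real)"
  define T where "T = real_of_int t"
  define \<phi> where "\<phi> = theta t - 1"
  \<comment> \<open>The coefficients of the line, \<open>3 u\<close> and \<open>3 v\<close> from the
    Pell equation. The term \<open>2 * a * b\<close> fixes their relative sign, negative only for
    \<open>t = 44103\<close>.\<close>
  have "\<exists>a b :: real. a \<in> \<rat> \<and> b \<in> \<rat> \<and> b ^ 2 = T - 3 \<and> a ^ 2 = 2 * T + 3 \<and> 2 * a * b + 9 * D ^ 4 = 3 * T"
  proof -
    consider "D = 1" "T = 3" | "D = 1" "T = 39" | "D = 13" "T = 44103" | "D = 13" "T = 1498179"
      using dt by (auto simp: D_def T_def)
    then show ?thesis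
    proof cases
      case 1 then show ?thesis by (intro exI[of _ 3] exI[of _ 0]) simp
    next
      case 2 then show ?thesis by (intro exI[of _ 9] exI[of _ 6]) simp
    next
      case 3 then show ?thesis by (intro exI[of _ "-297"] exI[of _ 210]) simp
    next
      case 4 then show ?thesis by (intro exI[of _ 1731] exI[of _ 1224]) simp
    qed
  qed
  then obtain a b where ab: "a \<in> \<rat>" "b \<in> \<rat>" "b ^ 2 = T - 3" "a ^ 2 = 2 * T + 3" "2 * a * b + 9 * D ^ 4 = 3 * T"
    by blast
  have D: "D > 0" "D \<in> \<rat>" using assms(1) by (simp_all add: D_def)
  interpret irreducible_cubic \<phi> "3 - T" "- 3 * T" "- (2 * T + 3)"
    unfolding \<phi>_def T_def using assms(2) by (rule irreducible_cubic_theta)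
  have "(a + b * \<phi>) ^ 2 = a ^ 2 + (2 * a * b + 9 * D ^ 4) * \<phi> + b ^ 2 * \<phi> ^ 2 - 9 * D ^ 4 * \<phi>"
    by (simp add: algebra_simps power2_eq_square)
  also have "\<dots> = \<phi> ^ 3 - 9 * D ^ 4 * \<phi>"
    unfolding ab using root by (simp add: algebra_simps)
  finally have sq: "(a + b * \<phi>) ^ 2 = \<phi> ^ 3 - 9 * D ^ 4 * \<phi>" .
  define x y where xy: "x = \<phi> / D ^ 2" "y = (a + b * \<phi>) / D ^ 3"
  have "y ^ 2 = x ^ 3 + -9 * x + 0"
    unfolding xy power_divide sq using D by (simp add: field_simps power_numeral_reduce)
  moreover have "x \<in> K t"
    using K_linear[of "- 1 / D ^ 2" "1 / D ^ 2" t] D by (simp add: xy \<phi>_def diff_divide_distrib)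
  moreover have "y \<in> K t"
  proof -
    have "y = (a - b) / D ^ 3 + b / D ^ 3 * theta t"
      unfolding xy \<phi>_def using D by (simp add: field_simps)
    then show ?thesis using K_linear[of "(a - b) / D ^ 3" "b / D ^ 3" t] ab D by simp
  qed
  ultimately have "Affine x y \<in> E3 (K t)" by (simp add: E3_def weierstrass_points_def)
  then show "\<exists>P \<in> E3 (K t). P \<noteq> Infinity \<and> abscissa P = (theta t - 1) / (of_rat d) ^ 2"
    by (intro bexI[of _ "Affine x y"]) (auto simp: xy \<phi>_def D_def)
qed

end
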